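(* Suppose no anticipation, overlap, repeated cross-sectional sampling, and time invariance hold (see context). Let $\theta=\mathbb E[Y_{\mathcal T}(1)-Y_{\mathcal T}(0)\mid G=1]$ and let $\phi_{\mathrm{rc}}$ be the moment function in the context. (i) If the parallel trends assumption (PT) holds, then $$\theta=\mathbb E[\phi_{\mathrm{rc}}(S^{\mathrm{rc}};\mu_{G\ne1,\mathcal T},\mu_{G\ne1,\mathcal T-1},\tilde p,\tilde w;\pi_1,\lambda_{\mathcal T},\lambda_{\mathcal T-1})]=\mathbb E[\phi_{\mathrm{rc}}(S^{\mathrm{rc}};\tilde\mu_{G\ne1,\mathcal T},\tilde\mu_{G\ne1,\mathcal T-1},p,\tilde w;\pi_1,\lambda_{\mathcal T},\lambda_{\mathcal T-1})]$$ for any vector of weight functions $\tilde w=(\tilde w_2,\dots,\tilde w_{N_G+1})$ whose elements sum to one, any non-zero functions $\tilde p=(\tilde p_1,\dots,\tilde p_{N_G+1})$, and any functions $(\tilde\mu_{G\ne1,\mathcal T},\tilde\mu_{G\ne1,\mathcal T-1})$. (ii) If the synthetic control assumption (SC) holds, then $$\theta=\mathbb E[\phi_{\mathrm{rc}}(S^{\mathrm{rc}};\tilde\mu_{G\ne1,\mathcal T},\tilde\mu_{G\ne1,\mathcal T-1},p,w;\pi_1,\lambda_{\mathcal T},\lambda_{\mathcal T-1})]$$ for any functions $(\tilde\mu_{G\ne1,\mathcal T},\tilde\mu_{G\ne1,\mathcal T-1})$, where $w$ is the vector of weight functions satisfying the equation in assumption (SC).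
   Context: Setting. There are $N_G+1$ groups; $G\in\{1,\dots,N_G+1\}$, $\mathcal G_g=\mathbf 1\{G=g\}$. Time periods are $t=1,\dots,\mathcal T$. Group $1$ is treated in the final period $\mathcal T$ only; other groups are never treated. $Y_t(1),Y_t(0)$, $t=1,\dots,\mathcal T$, are potential outcomes with and without the final-period treatment, and $Y_t=\mathcal G_1Y_t(1)+(1-\mathcal G_1)Y_t(0)$. $X$ is a set of covariates with support $\mathcal X$. $T\in\{1,\dots,\mathcal T\}$ is the period in which an individual is sampled, $\mathfrak T_t=\mathbf 1\{T=t\}$, and the observed outcome is $Y=\sum_{t=1}^{\mathcal T}\mathfrak T_tY_t$. Assumptions. No anticipation: $Y_t(1)=Y_t(0)$ for $t\le\mathcal T-1$. Overlap: $p_g(X)=\mathbb P(G=g\mid X)>0$ a.s. for all $g$; $p=(p_1,\dots,p_{N_G+1})$. Repeated cross-sectional sampling: an i.i.d. sample $\{S_i^{\mathrm{rc}}\}_{i=1}^n$ of $S^{\mathrm{rc}}=(Y,G,T,X)$ is observed. Time invariance: $(Y_1,\dots,Y_{\mathcal T},X,G)$ is independent of $T$, and $\lambda_t=\mathbb P(T=t)>0$ for each $t$. (PT): for each $g\ge2$, $\mathbb E[Y_{\mathcal T}(0)-Y_{\mathcal T-1}(0)\mid G=1,X]=\mathbb E[Y_{\mathcal T}(0)-Y_{\mathcal T-1}(0)\mid G=g,X]$ a.s. (SC): there is a vector of weight functions $w=(w_2,\dots,w_{N_G+1})$ with elements summing to one such that for almost all $x\in\mathcal X$, $\mathbb E[Y_t(0)\mid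 G=1,X=x]=\sum_{g=2}^{N_G+1}w_g(x)\mathbb E[Y_t(0)\mid G=g,X=x]$ for $t=1,\dots,\mathcal T$; and $\mathcal T\ge N_G$. Notation. $\pi_1=\mathbb P(G=1)$; $\mu_{G\ne1,t}(x)=\mathbb E[\mathfrak T_tY\mid G\ne1,X=x]$; and $$\phi_{\mathrm{rc}}(S^{\mathrm{rc}};\mu_{G\ne1,\mathcal T},\mu_{G\ne1,\mathcal T-1},p,w;\pi_1,\lambda_{\mathcal T},\lambda_{\mathcal T-1})=\frac1{\pi_1}\Big(\mathcal G_1-\sum_{g=2}^{N_G+1}\mathcal G_gw_g(X)\frac{p_1(X)}{p_g(X)}\Big)\Big(\Big(\frac{\mathfrak T_{\mathcal T}}{\lambda_{\mathcal T}}-\frac{\mathfrak T_{\mathcal T-1}}{\lambda_{\mathcal T-1}}\Big)Y-\Big(\frac{\mu_{G\ne1,\mathcal T}(X)}{\lambda_{\mathcal T}}-\frac{\mu_{G\ne1,\mathcal T-1}(X)}{\lambda_{\mathcal T-1}}\Big)\Big).$$ *)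

theory Defs
  imports "HOL-Probability.Probability"
begin

text \<open>The conditional law given the event Q.\<close>

definition given :: "'a measure \<Rightarrow> ('a \<Rightarrow> bool) \<Rightarrow> 'a measure" where
  "given M Q = uniform_measure M {\<omega> \<in> space M. Q \<omega>}"

text \<open>The conditional expectation of V given X under the law P. With P = given M Q this is the
  conditional expectation of V given Q and X; it is a random variable that is measurable with
  respect to the sigma-algebra generated by X.\<close>

definition cexp :: "'a measure \<Rightarrow> 'x measure \<Rightarrow> ('a \<Rightarrow> 'x) \<Rightarrow> ('a \<Rightarrow> real) \<Rightarrow> 'a \<Rightarrow> real" where
  "cexp P MX X V = real_cond_exp P (vimage_algebra (space P) X MX) V"

text \<open>m is a version of the regression function mapping x to the conditional expectation of V
  given X = x under P.\<close>

definition regression_fn ::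
  "'a measure \<Rightarrow> 'x measure \<Rightarrow> ('a \<Rightarrow> 'x) \<Rightarrow> ('a \<Rightarrow> real) \<Rightarrow> ('x \<Rightarrow> real) \<Rightarrow> bool" where
  "regression_fn P MX X V m \<longleftrightarrow>
     m \<in> borel_measurable MX \<and> (AE \<omega> in P. m (X \<omega>) = cexp P MX X V \<omega>)"

definition realized ::
  "('a \<Rightarrow> nat) \<Rightarrow> (nat \<Rightarrow> 'a \<Rightarrow> real) \<Rightarrow> (nat \<Rightarrow> 'a \<Rightarrow> real) \<Rightarrow> nat \<Rightarrow> 'a \<Rightarrow> real" where
  "realized G Y0 Y1 t \<omega> = of_bool (G \<omega> = 1) * Y1 t \<omega> + (1 - of_bool (G \<omega> = 1)) * Y0 t \<omega>"

definition observed ::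
  "nat \<Rightarrow> ('a \<Rightarrow> nat) \<Rightarrow> ('a \<Rightarrow> nat) \<Rightarrow> (nat \<Rightarrow> 'a \<Rightarrow> real) \<Rightarrow> (nat \<Rightarrow> 'a \<Rightarrow> real) \<Rightarrow> 'a \<Rightarrow> real" where
  "observed TT G T Y0 Y1 \<omega> = (\<Sum>t=1..TT. of_bool (T \<omega> = t) * realized G Y0 Y1 t \<omega>)"

definition S_rc ::
  "nat \<Rightarrow> ('a \<Rightarrow> nat) \<Rightarrow> ('a \<Rightarrow> nat) \<Rightarrow> ('a \<Rightarrow> 'x) \<Rightarrow> (nat \<Rightarrow> 'a \<Rightarrow> real) \<Rightarrow> (nat \<Rightarrow> 'a \<Rightarrow> real)
    \<Rightarrow> 'a \<Rightarrow> real \<times> nat \<times> nat \<times> 'x" where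
  "S_rc TT G T X Y0 Y1 \<omega> = (observed TT G T Y0 Y1 \<omega>, G \<omega>, T \<omega>, X \<omega>)"

definition no_anticipation ::
  "'a measure \<Rightarrow> nat \<Rightarrow> (nat \<Rightarrow> 'a \<Rightarrow> real) \<Rightarrow> (nat \<Rightarrow> 'a \<Rightarrow> real) \<Rightarrow> bool" where
  "no_anticipation M TT Y0 Y1 \<longleftrightarrow> (\<forall>t\<in>{1..TT-1}. AE \<omega> in M. Y1 t \<omega> = Y0 t \<omega>)"

definition overlap :: "'a measure \<Rightarrow> nat \<Rightarrow> ('a \<Rightarrow> 'x) \<Rightarrow> (nat \<Rightarrow> 'x \<Rightarrow> real) \<Rightarrow> bool" where
  "overlap M NG X p \<longleftrightarrow> (\<forall>g\<in>{1..NG+1}. AE \<omega> in M. p g (X \<omega>) > 0)"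

definition iid_sample ::
  "'b measure \<Rightarrow> nat \<Rightarrow> (nat \<Rightarrow> 'b \<Rightarrow> real \<times> nat \<times> nat \<times> 'x) \<Rightarrow> 'a measure \<Rightarrow> 'x measure
    \<Rightarrow> ('a \<Rightarrow> real \<times> nat \<times> nat \<times> 'x) \<Rightarrow> bool" where
  "iid_sample N n S M MX S0 \<longleftrightarrow>
     (let MS = borel \<Otimes>\<^sub>M (count_space UNIV \<Otimes>\<^sub>M (count_space UNIV \<Otimes>\<^sub>M MX)) in
       prob_space N \<and> prob_space.indep_vars N (\<lambda>_. MS) S {1..n} \<and>
       (\<forall>i\<in>{1..n}. distr N MS (S i) = distr M MS S0))"

text \<open>Independence is stated through the generated sigma-algebras because the two random elements
  take values in different types.\<close>

definition time_invariance ::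
  "'a measure \<Rightarrow> nat \<Rightarrow> ('a \<Rightarrow> nat) \<Rightarrow> ('a \<Rightarrow> nat) \<Rightarrow> 'x measure \<Rightarrow> ('a \<Rightarrow> 'x)
    \<Rightarrow> (nat \<Rightarrow> 'a \<Rightarrow> real) \<Rightarrow> (nat \<Rightarrow> 'a \<Rightarrow> real) \<Rightarrow> bool" where
  "time_invariance M TT G T MX X Y0 Y1 \<longleftrightarrow>
     prob_space.indep_set M
       (sets (vimage_algebra (space M) (\<lambda>\<omega>. ((\<lambda>t\<in>{1..TT}. realized G Y0 Y1 t \<omega>), X \<omega>, G \<omega>))
         ((\<Pi>\<^sub>M t\<in>{1..TT}. borel) \<Otimes>\<^sub>M (MX \<Otimes>\<^sub>M count_space UNIV))))
       (sets (vimage_algebra (space M) T (count_space UNIV))) \<and>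
     (\<forall>t\<in>{1..TT}. \<P>(\<omega> in M. T \<omega> = t) > 0)"

definition parallel_trends ::
  "'a measure \<Rightarrow> nat \<Rightarrow> nat \<Rightarrow> ('a \<Rightarrow> nat) \<Rightarrow> 'x measure \<Rightarrow> ('a \<Rightarrow> 'x) \<Rightarrow> (nat \<Rightarrow> 'a \<Rightarrow> real) \<Rightarrow> bool" where
  "parallel_trends M NG TT G MX X Y0 \<longleftrightarrow>
     (\<forall>g\<in>{2..NG+1}. AE \<omega> in M.
        cexp (given M (\<lambda>\<omega>. G \<omega> = 1)) MX X (\<lambda>\<omega>. Y0 TT \<omega> - Y0 (TT-1) \<omega>) \<omega> =
        cexp (given M (\<lambda>\<omega>. G \<omega> = g)) MX X (\<lambda>\<omega>. Y0 TT \<omega> - Y0 (TT-1) \<omega>) \<omega>)"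

text \<open>Weights may be negative.\<close>

definition weight_fns ::
  "'a measure \<Rightarrow> nat \<Rightarrow> 'x measure \<Rightarrow> ('a \<Rightarrow> 'x) \<Rightarrow> (nat \<Rightarrow> 'x \<Rightarrow> real) \<Rightarrow> bool" where
  "weight_fns M NG MX X w \<longleftrightarrow>
     (\<forall>g\<in>{2..NG+1}. w g \<in> borel_measurable MX) \<and>
     (AE \<omega> in M. (\<Sum>g=2..NG+1. w g (X \<omega>)) = 1)"

definition synthetic_control ::
  "'a measure \<Rightarrow> nat \<Rightarrow> nat \<Rightarrow> ('a \<Rightarrow> nat) \<Rightarrow> 'x measure \<Rightarrow> ('a \<Rightarrow> 'x) \<Rightarrow> (nat \<Rightarrow> 'a \<Rightarrow> real)
    \<Rightarrow> (nat \<Rightarrow> 'x \<Rightarrow> real) \<Rightarrow> bool" where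
  "synthetic_control M NG TT G MX X Y0 w \<longleftrightarrow>
     TT \<ge> NG \<and> weight_fns M NG MX X w \<and>
     (\<forall>t\<in>{1..TT}. AE \<omega> in M.
        cexp (given M (\<lambda>\<omega>. G \<omega> = 1)) MX X (Y0 t) \<omega> =
        (\<Sum>g=2..NG+1. w g (X \<omega>) * cexp (given M (\<lambda>\<omega>. G \<omega> = g)) MX X (Y0 t) \<omega>))"

text \<open>The arguments mT, mT1 and lT, lT1 belong to the periods TT and TT - 1.\<close>

fun phi_rc ::
  "nat \<Rightarrow> nat \<Rightarrow> real \<times> nat \<times> nat \<times> 'x \<Rightarrow> ('x \<Rightarrow> real) \<Rightarrow> ('x \<Rightarrow> real)
    \<Rightarrow> (nat \<Rightarrow> 'x \<Rightarrow> real) \<Rightarrow> (nat \<Rightarrow> 'x \<Rightarrow> real) \<Rightarrow> real \<Rightarrow> real \<Rightarrow> real \<Rightarrow> real" where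
  "phi_rc NG TT (y, g, t, x) mT mT1 p w \<pi>1 lT lT1 =
     1 / \<pi>1 * (of_bool (g = 1) - (\<Sum>h=2..NG+1. of_bool (g = h) * w h x * (p 1 x / p h x)))
       * ((of_bool (t = TT) / lT - of_bool (t = TT-1) / lT1) * y - (mT x / lT - mT1 x / lT1))"

end

theory Submission
  imports Defs
begin

text \<open>Independence of \<open>T\<close> turns the expectation of the moment function into that of the panel moment
  with \<open>R TT - R (TT - 1)\<close> in place of the period-weighted observed outcome. In group 1 this gives
  the effect plus the mean residual of the untreated trend \<open>D\<close>; it remains to see that this residual
  is offset by the weighted residuals of the controls. If the outcome regression is correct, all the
  residuals vanish. If the propensities are correct, \<open>p 1 / p h\<close> moves the residual of group \<open>h\<close> to
  the covariate distribution of group 1, where parallel trends or synthetic control equates the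
  weighted trend of the controls with that of group 1. Arbitrary nuisance functions are only known to
  make the whole moment integrable, so the argument never splits off a term whose integrability does
  not follow from that.\<close>

subsection \<open>Conditioning on an event\<close>

lemma space_given [simp]: "space (given M Q) = space M"
  and sets_given [simp, measurable_cong]: "sets (given M Q) = sets M"
  by (simp_all add: given_def)

context prob_space
begin

context
  fixes Q :: "'a \<Rightarrow> bool"
  assumes Q [measurable]: "Measurable.pred M Q"
    and Q_pos: "\<P>(\<omega> in M. Q \<omega>) > 0"
begin

text \<open>With a real-valued density, integrals under the conditional law can be rewritten by the
  density rules for Bochner integrals; the event then appears as a factor
  \<open>of_bool (Q \<omega>)\<close>.\<close>

lemma given_eq_density:
  "given M Q = density M (\<lambda>\<omega>. ennreal (of_bool (Q \<omega>) / \<P>(\<omega> in M. Q \<omega>)))"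
  unfolding given_def uniform_measure_def using Q_pos
  by (intro density_cong)
    (auto simp: emeasure_eq_measure indicator_def divide_ennreal[symmetric] intro!: AE_I2)

lemma prob_space_given: "prob_space (given M Q)"
  unfolding given_def using Q_pos by (intro prob_space_uniform_measure) (auto simp: emeasure_eq_measure)

lemma AE_given: "(AE \<omega> in given M Q. P \<omega>) \<longleftrightarrow> (AE \<omega> in M. Q \<omega> \<longrightarrow> P \<omega>)"
  unfolding given_eq_density using Q_pos by (subst AE_density) (auto intro!: AE_cong)

lemma integrable_given:
  assumes [measurable]: "f \<in> borel_measurable M"
  shows "integrable (given M Q) f \<longleftrightarrow> integrable M (\<lambda>\<omega>. of_bool (Q \<omega>) * f \<omega> :: real)"
proof -
  have "integrable (given M Q) f \<longleftrightarrow>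
      integrable M (\<lambda>\<omega>. (1 / \<P>(\<omega> in M. Q \<omega>)) * (of_bool (Q \<omega>) * f \<omega>))"
    unfolding given_eq_density using Q_pos by (subst integrable_density) auto
  also have "\<dots> \<longleftrightarrow> integrable M (\<lambda>\<omega>. of_bool (Q \<omega>) * f \<omega>)"
    using Q_pos by (subst integrable_mult_left_iff) auto
  finally show ?thesis .
qed

lemma integral_given:
  assumes [measurable]: "f \<in> borel_measurable M"
  shows "(LINT \<omega>|given M Q. f \<omega>) = (LINT \<omega>|M. of_bool (Q \<omega>) * f \<omega> :: real) / \<P>(\<omega> in M. Q \<omega>)"
  unfolding given_eq_density using Q_pos by (subst integral_density) auto

lemma integrable_givenI:
  assumes "integrable M f"
  shows "integrable (given M Q) (f :: 'a \<Rightarrow> real)"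
proof -
  have [measurable]: "f \<in> borel_measurable M"
    using assms by simp
  show ?thesis
    unfolding integrable_given[OF \<open>f \<in> borel_measurable M\<close>]
    by (rule Bochner_Integration.integrable_bound[OF assms]) auto
qed

end

end

subsection \<open>Conditional means given a covariate\<close>

context sigma_finite_subalgebra
begin

text \<open>Since \<open>c\<close> need not be integrable, linearity is applied after dividing the residual
  \<open>V - c\<close> by \<open>1 + \<bar>c\<bar>\<close>.\<close>

lemma real_cond_exp_residual:
  assumes V: "integrable M V"
    and f [measurable]: "f \<in> borel_measurable F" and c [measurable]: "c \<in> borel_measurable F"
    and int: "integrable M (\<lambda>\<omega>. f \<omega> * (V \<omega> - c \<omega>))" and "finite_measure M"
  shows "integrable M (\<lambda>\<omega>. f \<omega> * (real_cond_exp M F V \<omega> - c \<omega>))" (is ?I)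
    and "(LINT \<omega>|M. f \<omega> * (V \<omega> - c \<omega>)) = (LINT \<omega>|M. f \<omega> * (real_cond_exp M F V \<omega> - c \<omega>))" (is ?E)
proof -
  interpret fin: finite_measure M by fact
  define d where "d = (\<lambda>\<omega>. 1 + \<bar>c \<omega>\<bar>)"
  have d_pos: "d \<omega> > 0" for \<omega> by (simp add: d_def add_pos_nonneg)
  have [measurable]: "d \<in> borel_measurable F" unfolding d_def by measurable
  have [measurable]: "d \<in> borel_measurable M" "c \<in> borel_measurable M" "f \<in> borel_measurable M"
    "V \<in> borel_measurable M"
    using V by (auto intro: measurable_from_subalg[OF subalg])
  have iV: "integrable M (\<lambda>\<omega>. (1 / d \<omega>) * V \<omega>)"
    by (rule Bochner_Integration.integrable_bound[OF V])
      (auto simp: d_def abs_mult field_simps intro!: AE_I2 add_increasing2)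
  have ic: "integrable M (\<lambda>\<omega>. c \<omega> / d \<omega>)"
    by (rule fin.integrable_const_bound[where B = 1]) (auto simp: d_def)
  define g where "g = (\<lambda>\<omega>. (1 / d \<omega>) * V \<omega> - c \<omega> / d \<omega>)"
  have g_meas: "g \<in> borel_measurable M" unfolding g_def by measurable
  have fg: "f \<omega> * d \<omega> * g \<omega> = f \<omega> * (V \<omega> - c \<omega>)" for \<omega>
    using d_pos[of \<omega>] by (simp add: g_def field_simps)
  \<comment> \<open>The factor \<open>f * d\<close> is measurable with respect to \<open>F\<close>,
    so it can be pulled out of the conditional expectation. Only the product with \<open>g\<close>
    has to be integrable, and that product is the residual term assumed integrable.\<close>
  have "integrable M (\<lambda>\<omega>. (f \<omega> * d \<omega>) * g \<omega>)"
    using int by (simp add: fg)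
  note * = real_cond_exp_intg[OF this _ g_meas]
  have "AE \<omega> in M. real_cond_exp M F g \<omega> = (real_cond_exp M F V \<omega> - c \<omega>) / d \<omega>"
    using real_cond_exp_diff[OF iV ic] real_cond_exp_mult[OF _ _ iV] real_cond_exp_F_meas[OF ic]
    unfolding g_def by (auto simp: diff_divide_distrib)
  then have ae: "AE \<omega> in M. (f \<omega> * d \<omega>) * real_cond_exp M F g \<omega>
      = f \<omega> * (real_cond_exp M F V \<omega> - c \<omega>)"
  proof eventually_elim
    case (elim \<omega>)
    then show ?case using d_pos[of \<omega>] by simp
  qed
  have m: "(\<lambda>\<omega>. (f \<omega> * d \<omega>) * real_cond_exp M F g \<omega>) \<in> borel_measurable M"
    "(\<lambda>\<omega>. f \<omega> * (real_cond_exp M F V \<omega> - c \<omega>)) \<in> borel_measurable M"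
    by measurable
  show ?I
    using *(1) integrable_cong_AE[OF m ae] by simp
  show ?E
    using *(2) integral_cong_AE[OF m ae] by (simp add: fg)
qed

end

section \<open>The sigma-algebra generated by the covariate\<close>

locale covariate = prob_space M for M :: "'a measure" +
  fixes MX :: "'x measure" and X :: "'a \<Rightarrow> 'x"
  assumes X_meas [measurable]: "X \<in> measurable M MX"
begin

abbreviation "F \<equiv> vimage_algebra (space M) X MX"

lemma subalgebra_F: "subalgebra M F"
  using measurable_space[OF X_meas] measurable_sets[OF X_meas]
  by (auto simp: subalgebra_def sets_vimage_algebra2 Pi_iff)

lemma measurable_X_F [measurable]: "X \<in> measurable F MX"
  using measurable_space[OF X_meas] by (intro measurable_vimage_algebra1) auto

lemma F_measurable: "f \<in> borel_measurable F \<Longrightarrow> f \<in> borel_measurable M"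
  by (rule measurable_from_subalg[OF subalgebra_F])

lemma sigma_finite_subalgebra_F: "sigma_finite_subalgebra M F"
  by (intro finite_measure_subalgebra_is_sigma_finite)
    (simp add: finite_measure_subalgebra_def finite_measure_subalgebra_axioms_def subalgebra_F
      finite_measure_axioms)

text \<open>Conditioning on an event leaves \<open>space M\<close> unchanged, so a single
  sigma-algebra \<open>F\<close> serves the conditional laws of all groups.\<close>

lemma cexp_given: "cexp (given M Q) MX X V = real_cond_exp (given M Q) F V"
  by (simp add: cexp_def)

lemma cexp_F_measurable [measurable]: "cexp (given M Q) MX X V \<in> borel_measurable F"
  by (simp add: cexp_given)

lemma cexp_measurable [measurable]: "cexp (given M Q) MX X V \<in> borel_measurable M"
  by (rule F_measurable) measurable

lemma sigma_finite_subalgebra_given: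
  assumes "Measurable.pred M Q" "\<P>(\<omega> in M. Q \<omega>) > 0"
  shows "sigma_finite_subalgebra (given M Q) F"
proof -
  interpret P: prob_space "given M Q" by (rule prob_space_given[OF assms])
  show ?thesis
    using subalgebra_F
    by (intro finite_measure_subalgebra_is_sigma_finite)
      (simp add: finite_measure_subalgebra_def finite_measure_subalgebra_axioms_def
        subalgebra_def P.finite_measure_axioms)
qed

text \<open>This is \<open>real_cond_exp_residual\<close> under the law \<open>given M Q\<close>,
  carried back to \<open>M\<close>: the event becomes an indicator and the normalising probability
  cancels on both sides.\<close>

lemma cexp_residual:
  assumes Q [measurable]: "Measurable.pred M Q" and pos: "\<P>(\<omega> in M. Q \<omega>) > 0"
    and V: "integrable M V"
    and f [measurable]: "f \<in> borel_measurable F" and c [measurable]: "c \<in> borel_measurable F"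
    and int: "integrable M (\<lambda>\<omega>. of_bool (Q \<omega>) * (f \<omega> * (V \<omega> - c \<omega>)))"
  shows "integrable M (\<lambda>\<omega>. of_bool (Q \<omega>) * (f \<omega> * (cexp (given M Q) MX X V \<omega> - c \<omega>)))"
    and "(LINT \<omega>|M. of_bool (Q \<omega>) * (f \<omega> * (V \<omega> - c \<omega>))) =
      (LINT \<omega>|M. of_bool (Q \<omega>) * (f \<omega> * (cexp (given M Q) MX X V \<omega> - c \<omega>)))"
proof -
  interpret P: prob_space "given M Q" by (rule prob_space_given[OF Q pos])
  interpret S: sigma_finite_subalgebra "given M Q" F
    by (rule sigma_finite_subalgebra_given[OF Q pos])
  have [measurable]: "f \<in> borel_measurable M" "c \<in> borel_measurable M" "V \<in> borel_measurable M"
    using V by (simp_all add: F_measurable[OF f] F_measurable[OF c])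
  note * = S.real_cond_exp_residual[OF integrable_givenI[OF Q pos V] f c _ P.finite_measure_axioms,
      folded cexp_given]
  have int': "integrable (given M Q) (\<lambda>\<omega>. f \<omega> * (V \<omega> - c \<omega>))"
    using int by (subst integrable_given[OF Q pos]) auto
  show "integrable M (\<lambda>\<omega>. of_bool (Q \<omega>) * (f \<omega> * (cexp (given M Q) MX X V \<omega> - c \<omega>)))"
    using *(1)[OF int'] by (subst (asm) integrable_given[OF Q pos]) auto
  show "(LINT \<omega>|M. of_bool (Q \<omega>) * (f \<omega> * (V \<omega> - c \<omega>))) =
      (LINT \<omega>|M. of_bool (Q \<omega>) * (f \<omega> * (cexp (given M Q) MX X V \<omega> - c \<omega>)))"
    using *(2)[OF int'] pos by (simp add: integral_given[OF Q pos])
qed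

section \<open>Propensity scores and overlap\<close>

text \<open>Since \<open>k\<close> is a function of the covariate, the tower property replaces the
  indicator of \<open>Q\<close> by its conditional mean \<open>q (X \<omega>)\<close>. Integrability
  of \<open>k\<close> restricted to \<open>Q\<close> suffices, and it carries over to the weighted
  integrand.\<close>

lemma propensity_weighting:
  assumes Q [measurable]: "Measurable.pred M Q"
    and q: "regression_fn M MX X (\<lambda>\<omega>. of_bool (Q \<omega>)) q"
    and k [measurable]: "k \<in> borel_measurable F"
    and int: "integrable M (\<lambda>\<omega>. of_bool (Q \<omega>) * k \<omega>)"
  shows "integrable M (\<lambda>\<omega>. q (X \<omega>) * k \<omega>)"
    and "(LINT \<omega>|M. of_bool (Q \<omega>) * k \<omega>) = (LINT \<omega>|M. q (X \<omega>) * k \<omega>)"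
proof -
  interpret S: sigma_finite_subalgebra M F by (rule sigma_finite_subalgebra_F)
  have [measurable]: "k \<in> borel_measurable M" "q \<in> borel_measurable MX"
    using q by (simp_all add: regression_fn_def F_measurable[OF k])
  have "integrable M (\<lambda>\<omega>. k \<omega> * of_bool (Q \<omega>))"
    using int by (simp add: mult.commute)
  note * = S.real_cond_exp_intg[OF this k]
  have ae: "AE \<omega> in M. k \<omega> * real_cond_exp M F (\<lambda>\<omega>. of_bool (Q \<omega>)) \<omega> = q (X \<omega>) * k \<omega>"
    using q by (auto simp: regression_fn_def cexp_def)
  have m: "(\<lambda>\<omega>. k \<omega> * real_cond_exp M F (\<lambda>\<omega>. of_bool (Q \<omega>)) \<omega>) \<in> borel_measurable M"
    "(\<lambda>\<omega>. q (X \<omega>) * k \<omega>) \<in> borel_measurable M"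
    by measurable
  show "integrable M (\<lambda>\<omega>. q (X \<omega>) * k \<omega>)"
    using *(1) integrable_cong_AE[OF m ae] by simp
  show "(LINT \<omega>|M. of_bool (Q \<omega>) * k \<omega>) = (LINT \<omega>|M. q (X \<omega>) * k \<omega>)"
    using *(2) integral_cong_AE[OF m ae] by (simp add: mult.commute)
qed

text \<open>If \<open>Q\<close> were a null event, weighting with \<open>k = 1\<close> would give
  \<open>q (X \<omega>)\<close> mean zero, which contradicts its positivity.\<close>

lemma prob_pos_if_propensity_pos:
  assumes Q [measurable]: "Measurable.pred M Q"
    and q: "regression_fn M MX X (\<lambda>\<omega>. of_bool (Q \<omega>)) q" and pos: "AE \<omega> in M. q (X \<omega>) > 0"
  shows "\<P>(\<omega> in M. Q \<omega>) > 0"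
proof (rule ccontr)
  assume "\<not> ?thesis"
  then have 0: "\<P>(\<omega> in M. Q \<omega>) = 0"
    using measure_nonneg[of M "{\<omega> \<in> space M. Q \<omega>}"] by linarith
  have "AE \<omega> in M. \<not> Q \<omega>"
    using 0 by (subst prob_Collect_eq_0[symmetric]) auto
  then have "(LINT \<omega>|M. of_bool (Q \<omega>) * 1) = (LINT \<omega>|M. 0 :: real)"
    by (intro integral_cong_AE) auto
  moreover have i: "integrable M (\<lambda>\<omega>. of_bool (Q \<omega>) * (1::real))"
    by (rule integrable_const_bound[where B = 1]) auto
  ultimately have "(LINT \<omega>|M. q (X \<omega>) * 1) = 0"
    using propensity_weighting(2)[OF Q q _ i] by simp
  then have "AE \<omega> in M. q (X \<omega>) * 1 = 0"
    using propensity_weighting(1)[OF Q q _ i] pos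
    by (subst (asm) integral_nonneg_eq_0_iff_AE) auto
  with pos have "AE \<omega> in M. False" by eventually_elim simp
  then show False by simp
qed

text \<open>A conditional mean under \<open>given M Q\<close> is determined only almost everywhere
  on \<open>Q\<close>, whereas trends of different groups are compared on the whole space. The set
  where \<open>u\<close> and \<open>v\<close> differ belongs to \<open>F\<close> and meets
  \<open>Q\<close> in a null set; weighting its indicator by the positive propensity shows that it
  is null itself.\<close>

lemma AE_eq_if_propensity_pos:
  assumes Q [measurable]: "Measurable.pred M Q"
    and q: "regression_fn M MX X (\<lambda>\<omega>. of_bool (Q \<omega>)) q" and pos: "AE \<omega> in M. q (X \<omega>) > 0"
    and u [measurable]: "u \<in> borel_measurable F" and v [measurable]: "v \<in> borel_measurable F"
    and eq: "AE \<omega> in M. Q \<omega> \<longrightarrow> u \<omega> = (v \<omega> :: real)"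
  shows "AE \<omega> in M. u \<omega> = v \<omega>"
proof -
  define k where "k = (\<lambda>\<omega>. of_bool (u \<omega> \<noteq> v \<omega>) :: real)"
  have k [measurable]: "k \<in> borel_measurable F" unfolding k_def by measurable
  then have [measurable]: "k \<in> borel_measurable M" by (rule F_measurable)
  have i: "integrable M (\<lambda>\<omega>. of_bool (Q \<omega>) * k \<omega>)"
    by (rule integrable_const_bound[where B = 1]) (rule AE_I2, simp add: k_def, measurable)
  have "AE \<omega> in M. of_bool (Q \<omega>) * k \<omega> = 0"
    using eq by eventually_elim (simp add: k_def)
  then have "(LINT \<omega>|M. of_bool (Q \<omega>) * k \<omega>) = 0"
    by (rule integral_eq_zero_AE)
  then have "(LINT \<omega>|M. q (X \<omega>) * k \<omega>) = 0"
    using propensity_weighting(2)[OF Q q k i] by simp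
  moreover have "AE \<omega> in M. 0 \<le> q (X \<omega>) * k \<omega>"
    using pos by eventually_elim (simp add: k_def)
  ultimately have "AE \<omega> in M. q (X \<omega>) * k \<omega> = 0"
    using propensity_weighting(1)[OF Q q k i] by (simp add: integral_nonneg_eq_0_iff_AE)
  with pos show ?thesis
    by eventually_elim (simp add: k_def split: if_splits)
qed

end


subsection \<open>Repeated cross sections\<close>

locale repeated_cross_sections = covariate M MX X
  for M :: "'a measure" and MX :: "'x measure" and X :: "'a \<Rightarrow> 'x" +
  fixes NG TT :: nat and G T :: "'a \<Rightarrow> nat" and Y0 Y1 :: "nat \<Rightarrow> 'a \<Rightarrow> real"
    and p :: "nat \<Rightarrow> 'x \<Rightarrow> real" and lam :: "nat \<Rightarrow> real"
  assumes TT: "TT \<ge> 2"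
    and G_meas [measurable]: "G \<in> measurable M (count_space UNIV)"
    and G_range: "\<And>\<omega>. \<omega> \<in> space M \<Longrightarrow> G \<omega> \<in> {1..NG+1}"
    and T_meas [measurable]: "T \<in> measurable M (count_space UNIV)"
    and T_range: "\<And>\<omega>. \<omega> \<in> space M \<Longrightarrow> T \<omega> \<in> {1..TT}"
    and Y0_int: "\<And>t. t \<in> {1..TT} \<Longrightarrow> integrable M (Y0 t)"
    and Y1_meas: "\<And>t. t \<in> {1..TT} \<Longrightarrow> Y1 t \<in> borel_measurable M"
    and Y1_int: "set_integrable M {\<omega> \<in> space M. G \<omega> = 1} (Y1 TT)"
    and p: "\<And>g. g \<in> {1..NG+1} \<Longrightarrow> regression_fn M MX X (\<lambda>\<omega>. of_bool (G \<omega> = g)) (p g)"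
    and lam: "\<And>t. t \<in> {1..TT} \<Longrightarrow> lam t = \<P>(\<omega> in M. T \<omega> = t)"
    and no_anticipation: "no_anticipation M TT Y0 Y1"
    and overlap: "overlap M NG X p"
    and time_invariance: "time_invariance M TT G T MX X Y0 Y1"
begin

abbreviation "R \<equiv> realized G Y0 Y1"

abbreviation "D \<equiv> \<lambda>\<omega>. Y0 TT \<omega> - Y0 (TT - 1) \<omega>"

abbreviation "\<Delta> g \<equiv> cexp (given M (\<lambda>\<omega>. G \<omega> = g)) MX X D"

abbreviation "outcome_map \<equiv> \<lambda>\<omega>. ((\<lambda>t\<in>{1..TT}. R t \<omega>), X \<omega>, G \<omega>)"

abbreviation "MO \<equiv> (\<Pi>\<^sub>M t\<in>{1..TT}. borel) \<Otimes>\<^sub>M (MX \<Otimes>\<^sub>M count_space (UNIV :: nat set))"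

abbreviation "H \<equiv> vimage_algebra (space M) outcome_map MO"

text \<open>With \<open>TT \<ge> 2\<close> the truncated difference \<open>TT - 1\<close> is a
  genuine period; the third fact places it among the periods covered by no anticipation.\<close>

lemma last_periods: "TT \<in> {1..TT}" "TT - 1 \<in> {1..TT}" "TT - 1 \<in> {1..TT-1}" "TT - 1 \<noteq> TT"
  using TT by auto

lemma lam_pos: "t \<in> {1..TT} \<Longrightarrow> lam t > 0"
  using time_invariance lam by (auto simp: time_invariance_def)

text \<open>Needed so that averaging over the sampling period reproduces
  \<open>c (X \<omega>)\<close> with total weight one.\<close>

lemma sum_lam: "(\<Sum>t=1..TT. lam t) = 1"
proof -
  have "(\<Sum>t=1..TT. lam t) = (\<Sum>t=1..TT. prob {\<omega> \<in> space M. T \<omega> = t})"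
    by (intro sum.cong) (auto simp: lam)
  also have "\<dots> = prob (\<Union>t\<in>{1..TT}. {\<omega> \<in> space M. T \<omega> = t})"
    by (intro finite_measure_finite_Union[symmetric]) (auto simp: disjoint_family_on_def)
  also have "(\<Union>t\<in>{1..TT}. {\<omega> \<in> space M. T \<omega> = t}) = space M"
    using T_range by auto
  finally show ?thesis
    by (simp add: prob_space)
qed

lemma group_prob_pos: "g \<in> {1..NG+1} \<Longrightarrow> \<P>(\<omega> in M. G \<omega> = g) > 0"
  using overlap by (intro prob_pos_if_propensity_pos[OF _ p]) (auto simp: overlap_def)

lemma D_int: "integrable M D"
  using last_periods by (intro Bochner_Integration.integrable_diff Y0_int) auto

lemma AE_eq_if_AE_eq_group:
  assumes "g \<in> {1..NG+1}" "u \<in> borel_measurable F" "v \<in> borel_measurable F"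
    "AE \<omega> in M. G \<omega> = g \<longrightarrow> u \<omega> = (v \<omega> :: real)"
  shows "AE \<omega> in M. u \<omega> = v \<omega>"
  using assms overlap
  by (intro AE_eq_if_propensity_pos[OF _ p[OF assms(1)]]) (auto simp: overlap_def)

text \<open>Independence makes \<open>lam t\<close> the conditional expectation of the indicator of \<open>T = t\<close> given \<open>H\<close>;
  this also transfers integrability to \<open>Z\<close>.\<close>

lemma integral_sampling_period:
  assumes Z [measurable]: "Z \<in> borel_measurable H" and t: "t \<in> {1..TT}"
    and int: "integrable M (\<lambda>\<omega>. of_bool (T \<omega> = t) * Z \<omega>)"
  shows "integrable M Z" and "(LINT \<omega>|M. of_bool (T \<omega> = t) * Z \<omega>) = lam t * (LINT \<omega>|M. Z \<omega>)"
proof -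
  have ind: "indep_set (sets H) (sets (vimage_algebra (space M) T (count_space UNIV)))"
    using time_invariance by (simp add: time_invariance_def)
  have sub: "subalgebra M H"
    using indep_setD_ev1[OF ind] by (simp add: subalgebra_def)
  interpret S: sigma_finite_subalgebra M H
    by (intro finite_measure_subalgebra_is_sigma_finite)
      (simp add: finite_measure_subalgebra_def finite_measure_subalgebra_axioms_def sub
        finite_measure_axioms del: One_nat_def)
  have it: "integrable M (\<lambda>\<omega>. of_bool (T \<omega> = t) :: real)"
    by (rule integrable_const_bound[where B = 1]) auto
  have ae: "AE \<omega> in M. real_cond_exp M H (\<lambda>\<omega>. of_bool (T \<omega> = t)) \<omega> = lam t"
  proof (rule S.real_cond_exp_charact[OF _ it])
    fix A assume A: "A \<in> sets H"
    then have [measurable]: "A \<in> sets M"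
      using sub by (auto simp: subalgebra_def)
    have "T -` {t} \<inter> space M \<in> sets (vimage_algebra (space M) T (count_space UNIV))"
      by (rule in_vimage_algebra) simp
    \<comment> \<open>Time invariance enters here: \<open>A\<close> is determined by realized
      outcomes, covariate and group, hence is independent of the sampling period.\<close>
    then have "prob (A \<inter> (T -` {t} \<inter> space M)) = prob A * prob (T -` {t} \<inter> space M)"
      by (rule indep_setD[OF ind A])
    also have "T -` {t} \<inter> space M = {\<omega> \<in> space M. T \<omega> = t}" by auto
    finally have eq: "prob (A \<inter> {\<omega> \<in> space M. T \<omega> = t}) = prob A * lam t"
      using t by (simp add: lam)
    have "(LINT \<omega>:A|M. of_bool (T \<omega> = t)) = (LINT \<omega>|M. indicator (A \<inter> {\<omega> \<in> space M. T \<omega> = t}) \<omega>)"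
      unfolding set_lebesgue_integral_def
      by (intro Bochner_Integration.integral_cong) (auto simp: indicator_def)
    also have "\<dots> = prob A * lam t"
      using eq by (subst Bochner_Integration.integral_indicator) (auto simp: Int_absorb2 sets.sets_into_space)
    also have "\<dots> = (LINT \<omega>:A|M. lam t)"
      by (simp add: set_lebesgue_integral_def Int_absorb2 sets.sets_into_space)
    finally show "(LINT \<omega>:A|M. of_bool (T \<omega> = t)) = (LINT \<omega>:A|M. lam t)" .
  qed auto
  have [measurable]: "Z \<in> borel_measurable M" by (rule measurable_from_subalg[OF sub Z])
  have "integrable M (\<lambda>\<omega>. Z \<omega> * of_bool (T \<omega> = t))"
    using int by (simp add: mult.commute)
  note * = S.real_cond_exp_intg[OF this Z]
  have ae': "AE \<omega> in M. Z \<omega> * real_cond_exp M H (\<lambda>\<omega>. of_bool (T \<omega> = t)) \<omega> = lam t * Z \<omega>"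
    using ae by eventually_elim simp
  have m: "(\<lambda>\<omega>. Z \<omega> * real_cond_exp M H (\<lambda>\<omega>. of_bool (T \<omega> = t)) \<omega>) \<in> borel_measurable M"
    "(\<lambda>\<omega>. lam t * Z \<omega>) \<in> borel_measurable M"
    by measurable
  have "integrable M (\<lambda>\<omega>. lam t * Z \<omega>)"
    using *(1) integrable_cong_AE[OF m ae'] by simp
  then show "integrable M Z"
    using lam_pos[OF t] by (subst (asm) integrable_mult_left_iff) auto
  show "(LINT \<omega>|M. of_bool (T \<omega> = t) * Z \<omega>) = lam t * (LINT \<omega>|M. Z \<omega>)"
    using *(2) integral_cong_AE[OF m ae'] by (simp add: mult.commute)
qed

text \<open>The restricted lambda makes the outcome path extensional, so that it lies in the product
  space; the preimage sigma-algebra makes a map measurable only if its values lie in the target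
  space.\<close>

lemma outcome_map_measurable: "outcome_map \<in> measurable H MO"
proof (rule measurable_vimage_algebra1)
  show "outcome_map \<in> space M \<rightarrow> space MO"
    using measurable_space[OF X_meas]
    by (auto simp: space_pair_measure space_PiM PiE_def extensional_def)
qed

lemma measurable_H [measurable]:
  "X \<in> measurable H MX" "G \<in> measurable H (count_space UNIV)"
  using measurable_compose[OF outcome_map_measurable measurable_compose[OF measurable_snd measurable_fst]]
    measurable_compose[OF outcome_map_measurable measurable_compose[OF measurable_snd measurable_snd]]
  by simp_all

text \<open>Time invariance concerns realized outcomes, and the potential outcomes
  \<open>Y0 t\<close> and \<open>Y1 t\<close> need not be measurable with respect to
  \<open>H\<close>. Every use of independence therefore goes through \<open>R t\<close>.\<close>

lemma realized_H_measurable: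
  assumes t: "t \<in> {1..TT}"
  shows "R t \<in> borel_measurable H"
proof -
  have "(\<lambda>\<omega>. fst (outcome_map \<omega>) t) \<in> borel_measurable H"
    by (rule measurable_compose[OF measurable_compose[OF outcome_map_measurable measurable_fst]
          measurable_component_singleton[OF t]])
  then show ?thesis using t by simp
qed

lemma realized_measurable: "t \<in> {1..TT} \<Longrightarrow> R t \<in> borel_measurable M"
  using Y1_meas Y0_int unfolding realized_def[abs_def] by measurable

lemma observed_eq:
  assumes "t \<in> {1..TT}" "T \<omega> = t"
  shows "observed TT G T Y0 Y1 \<omega> = R t \<omega>"
  using assms by (simp add: observed_def of_bool_def if_distrib[of "\<lambda>x. x * _"] cong: if_cong)

subsection \<open>The moment function\<close>

text \<open>The bracket of group indicators in \<open>phi_rc\<close>, with \<open>a h\<close>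
  standing for the weight of group \<open>h\<close> times the ratio of propensities.\<close>

definition group_weight :: "(nat \<Rightarrow> 'x \<Rightarrow> real) \<Rightarrow> 'a \<Rightarrow> real" where
  "group_weight a \<omega> = of_bool (G \<omega> = 1) - (\<Sum>h=2..NG+1. of_bool (G \<omega> = h) * a h (X \<omega>))"

context
  fixes a :: "nat \<Rightarrow> 'x \<Rightarrow> real" and c :: "'x \<Rightarrow> real"
  assumes a [measurable]: "\<And>h. h \<in> {2..NG+1} \<Longrightarrow> a h \<in> borel_measurable MX"
    and c [measurable]: "c \<in> borel_measurable MX"
begin

lemma group_weight_H_measurable [measurable]: "group_weight a \<in> borel_measurable H"
  unfolding group_weight_def[abs_def] by measurable

lemma group_weight_1: "of_bool (G \<omega> = 1) * group_weight a \<omega> = of_bool (G \<omega> = 1)"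
  by (simp add: group_weight_def)

lemma group_weight_control:
  assumes "h \<in> {2..NG+1}"
  shows "of_bool (G \<omega> = h) * group_weight a \<omega> = - of_bool (G \<omega> = h) * a h (X \<omega>)"
proof (cases "G \<omega> = h")
  case True
  have "(\<Sum>j=2..NG+1. of_bool (G \<omega> = j) * a j (X \<omega>)) = (\<Sum>j=2..NG+1. if j = h then a j (X \<omega>) else 0)"
    using True by (intro sum.cong) auto
  then show ?thesis using assms True by (simp add: group_weight_def)
qed simp

text \<open>The average over \<open>t\<close> of the period-\<open>t\<close> moments with weights \<open>lam t\<close> is the panel moment; it
  inherits integrability, although \<open>group_weight * R t\<close> and \<open>group_weight * c X\<close> separately need not be integrable.\<close>

lemma moment_panel:
  fixes \<psi> :: "'a \<Rightarrow> real"
  defines "\<psi> \<equiv> \<lambda>\<omega>. group_weight a \<omega> * ((of_bool (T \<omega> = TT) / lam TT - of_bool (T \<omega> = TT - 1) / lam (TT - 1))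
      * observed TT G T Y0 Y1 \<omega> - c (X \<omega>))"
  assumes int: "integrable M \<psi>"
  shows "integrable M (\<lambda>\<omega>. group_weight a \<omega> * (R TT \<omega> - R (TT - 1) \<omega> - c (X \<omega>)))"
    and "(LINT \<omega>|M. \<psi> \<omega>) = (LINT \<omega>|M. group_weight a \<omega> * (R TT \<omega> - R (TT - 1) \<omega> - c (X \<omega>)))"
proof -
  \<comment> \<open>The signed sampling weight at period \<open>t\<close>. On the event
    \<open>T = t\<close> the moment coincides with \<open>Z t\<close>, which no longer involves
    \<open>T\<close> and is measurable with respect to \<open>H\<close>.\<close>
  define e where "e = (\<lambda>t. (of_bool (t = TT) / lam TT - of_bool (t = TT - 1) / lam (TT - 1)) :: real)"
  define Z where "Z = (\<lambda>t \<omega>. group_weight a \<omega> * (e t * R t \<omega> - c (X \<omega>)))"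
  have Z_meas: "Z t \<in> borel_measurable H" if "t \<in> {1..TT}" for t
    using realized_H_measurable[OF that] unfolding Z_def by measurable
  have part: "of_bool (T \<omega> = t) * \<psi> \<omega> = of_bool (T \<omega> = t) * Z t \<omega>" if "t \<in> {1..TT}" for t \<omega>
    using observed_eq[OF that] by (auto simp: \<psi>_def Z_def e_def)
  have int_part: "integrable M (\<lambda>\<omega>. of_bool (T \<omega> = t) * Z t \<omega>)" if "t \<in> {1..TT}" for t
    unfolding part[OF that, symmetric]
    by (rule Bochner_Integration.integrable_bound[OF int]) (use int in auto)
  note Z = integral_sampling_period[OF Z_meas _ int_part]
  \<comment> \<open>Each period carries the term \<open>- c (X \<omega>)\<close>, including those
    with \<open>e t = 0\<close>, so the average has to run over all periods and not only the last
    two.\<close>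
  have "(\<Sum>t=1..TT. lam t * Z t \<omega>) =
      group_weight a \<omega> * ((\<Sum>t=1..TT. lam t * e t * R t \<omega>) - (\<Sum>t=1..TT. lam t) * c (X \<omega>))" for \<omega>
    by (simp add: Z_def sum_distrib_left sum_distrib_right sum_subtractf algebra_simps)
  \<comment> \<open>The product \<open>lam t * e t\<close> is 1 at \<open>TT\<close>, -1 at
    \<open>TT - 1\<close> and 0 elsewhere.\<close>
  moreover have "(\<Sum>t=1..TT. lam t * e t * R t \<omega>) = R TT \<omega> - R (TT - 1) \<omega>" for \<omega>
  proof -
    have "(\<Sum>t=1..TT. lam t * e t * R t \<omega>) =
        (\<Sum>t=1..TT. (if t = TT then R t \<omega> else 0) - (if t = TT - 1 then R t \<omega> else 0))"
      using lam_pos[OF last_periods(1)] lam_pos[OF last_periods(2)] last_periods(4)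
      by (intro sum.cong) (auto simp: e_def)
    then show ?thesis
      using last_periods by (simp add: sum_subtractf)
  qed
  ultimately have eq: "(\<Sum>t=1..TT. lam t * Z t \<omega>) = group_weight a \<omega> * (R TT \<omega> - R (TT - 1) \<omega> - c (X \<omega>))" for \<omega>
    by (simp add: sum_lam del: One_nat_def)
  show "integrable M (\<lambda>\<omega>. group_weight a \<omega> * (R TT \<omega> - R (TT - 1) \<omega> - c (X \<omega>)))"
    unfolding eq[symmetric] using Z(1) by (intro Bochner_Integration.integrable_sum) auto
  have "\<psi> \<omega> = (\<Sum>t=1..TT. of_bool (T \<omega> = t) * Z t \<omega>)" if "\<omega> \<in> space M" for \<omega>
  proof -
    have "(\<Sum>t=1..TT. of_bool (T \<omega> = t) * Z t \<omega>) = (\<Sum>t=1..TT. of_bool (T \<omega> = t) * \<psi> \<omega>)"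
      by (intro sum.cong) (simp_all add: part)
    also have "\<dots> = (\<Sum>t=1..TT. if t = T \<omega> then \<psi> \<omega> else 0)"
      by (intro sum.cong) auto
    finally show ?thesis using T_range[OF that] by simp
  qed
  then have "(LINT \<omega>|M. \<psi> \<omega>) = (LINT \<omega>|M. (\<Sum>t=1..TT. of_bool (T \<omega> = t) * Z t \<omega>))"
    by (intro Bochner_Integration.integral_cong) auto
  also have "\<dots> = (\<Sum>t=1..TT. lam t * (LINT \<omega>|M. Z t \<omega>))"
    using int_part Z(2) by (subst Bochner_Integration.integral_sum) auto
  also have "\<dots> = (LINT \<omega>|M. (\<Sum>t=1..TT. lam t * Z t \<omega>))"
    using Z(1) by (subst Bochner_Integration.integral_sum) auto
  finally show "(LINT \<omega>|M. \<psi> \<omega>) = (LINT \<omega>|M. group_weight a \<omega> * (R TT \<omega> - R (TT - 1) \<omega> - c (X \<omega>)))"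
    by (simp only: eq)
qed

text \<open>Restricting \<open>K\<close> to one group keeps it integrable, since a group indicator
  is at most one. In group 1 the restriction is the effect plus the residual of \<open>D\<close>; in
  control group \<open>h\<close> it is minus the residual weighted by \<open>a h\<close>.\<close>

lemma panel_moment_groups:
  fixes K :: "'a \<Rightarrow> real"
  defines "K \<equiv> \<lambda>\<omega>. group_weight a \<omega> * (R TT \<omega> - R (TT - 1) \<omega> - c (X \<omega>))"
  assumes int: "integrable M K"
  shows "integrable M (\<lambda>\<omega>. of_bool (G \<omega> = 1) * (D \<omega> - c (X \<omega>)))"
    and "h \<in> {2..NG+1} \<Longrightarrow> integrable M (\<lambda>\<omega>. of_bool (G \<omega> = h) * (a h (X \<omega>) * (D \<omega> - c (X \<omega>))))"
    and "(LINT \<omega>|M. K \<omega>) = (LINT \<omega>|M. of_bool (G \<omega> = 1) * (Y1 TT \<omega> - Y0 TT \<omega>))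
      + (LINT \<omega>|M. of_bool (G \<omega> = 1) * (D \<omega> - c (X \<omega>)))
      - (\<Sum>h=2..NG+1. LINT \<omega>|M. of_bool (G \<omega> = h) * (a h (X \<omega>) * (D \<omega> - c (X \<omega>))))"
proof -
  have [measurable]: "Y0 TT \<in> borel_measurable M" "Y0 (TT - 1) \<in> borel_measurable M"
      "Y1 TT \<in> borel_measurable M"
    using Y0_int Y1_meas last_periods by auto
  define effect where "effect = (\<lambda>\<omega>. of_bool (G \<omega> = 1) * (Y1 TT \<omega> - Y0 TT \<omega>))"
  define A where "A = (\<lambda>\<omega>. of_bool (G \<omega> = 1) * (D \<omega> - c (X \<omega>)))"
  define B where "B = (\<lambda>h \<omega>. of_bool (G \<omega> = h) * (a h (X \<omega>) * (D \<omega> - c (X \<omega>))))"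
  have intK: "integrable M (\<lambda>\<omega>. of_bool (G \<omega> = g) * K \<omega>)" for g
    by (rule Bochner_Integration.integrable_bound[OF int]) (use int in auto)
  have "integrable M (\<lambda>\<omega>. indicator {\<omega> \<in> space M. G \<omega> = 1} \<omega> * Y1 TT \<omega>)"
    using Y1_int by (simp add: set_integrable_def)
  then have "integrable M (\<lambda>\<omega>. of_bool (G \<omega> = 1) * Y1 TT \<omega>)"
    by (rule Bochner_Integration.integrable_cong[THEN iffD1, rotated -1]) (auto simp: indicator_def)
  moreover have "integrable M (\<lambda>\<omega>. of_bool (G \<omega> = 1) * Y0 TT \<omega>)"
    by (rule Bochner_Integration.integrable_bound[OF Y0_int[OF last_periods(1)]]) auto
  ultimately have int_effect: "integrable M effect"
    unfolding effect_def right_diff_distrib by (rule Bochner_Integration.integrable_diff)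
  have na: "AE \<omega> in M. Y1 (TT - 1) \<omega> = Y0 (TT - 1) \<omega>"
    using no_anticipation last_periods by (auto simp: no_anticipation_def)
  have [measurable]: "Y1 (TT - 1) \<in> borel_measurable M" "R TT \<in> borel_measurable M"
      "R (TT - 1) \<in> borel_measurable M" "K \<in> borel_measurable M"
    using Y1_meas realized_measurable last_periods int by auto
  \<comment> \<open>By no anticipation the earlier realized outcome of group 1 is
    \<open>Y0 (TT - 1)\<close>, so its realized change is \<open>Y1 TT - Y0 TT\<close> plus the
    untreated trend \<open>D\<close>.\<close>
  have K1: "AE \<omega> in M. of_bool (G \<omega> = 1) * K \<omega> = effect \<omega> + A \<omega>"
    using na
  proof eventually_elim
    case (elim \<omega>)
    then show ?case
      using group_weight_1[of \<omega>] by (auto simp: K_def effect_def A_def realized_def)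
  qed
  have m: "(\<lambda>\<omega>. of_bool (G \<omega> = 1) * K \<omega>) \<in> borel_measurable M"
    "(\<lambda>\<omega>. effect \<omega> + A \<omega>) \<in> borel_measurable M"
    unfolding effect_def A_def by measurable
  have int_eA: "integrable M (\<lambda>\<omega>. effect \<omega> + A \<omega>)"
    using intK[of 1] integrable_cong_AE[OF m K1] by simp
  \<comment> \<open>The residual may contain an arbitrary \<open>c\<close>; its integrability is
    obtained by subtracting the integrable effect from the restriction of \<open>K\<close>.\<close>
  from Bochner_Integration.integrable_diff[OF this int_effect] have intA: "integrable M A"
    by simp
  then show "integrable M (\<lambda>\<omega>. of_bool (G \<omega> = 1) * (D \<omega> - c (X \<omega>)))"
    by (simp add: A_def)
  have Kh: "of_bool (G \<omega> = h) * K \<omega> = - B h \<omega>" if "h \<in> {2..NG+1}" for h \<omega>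
    using group_weight_control[OF that, of \<omega>] that by (auto simp: K_def B_def realized_def)
  have intB: "integrable M (B h)" if "h \<in> {2..NG+1}" for h
    using intK[of h] by (simp add: Kh[OF that])
  then show "h \<in> {2..NG+1} \<Longrightarrow> integrable M (\<lambda>\<omega>. of_bool (G \<omega> = h) * (a h (X \<omega>) * (D \<omega> - c (X \<omega>))))"
    by (simp add: B_def)
  \<comment> \<open>Exactly one group indicator is one at each point, so \<open>K\<close> is the sum
    of its restrictions to the groups.\<close>
  have Ksum: "K \<omega> = of_bool (G \<omega> = 1) * K \<omega> - (\<Sum>h=2..NG+1. B h \<omega>)" if "\<omega> \<in> space M" for \<omega>
  proof -
    have "(\<Sum>h=2..NG+1. B h \<omega>) = - (\<Sum>h=2..NG+1. of_bool (G \<omega> = h) * K \<omega>)"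
      unfolding sum_negf[symmetric] by (intro sum.cong) (simp_all add: Kh)
    also have "(\<Sum>h=2..NG+1. of_bool (G \<omega> = h) * K \<omega>) = (\<Sum>h=2..NG+1. if h = G \<omega> then K \<omega> else 0)"
      by (intro sum.cong) auto
    finally show ?thesis using G_range[OF that] by auto
  qed
  have "(LINT \<omega>|M. K \<omega>) = (LINT \<omega>|M. of_bool (G \<omega> = 1) * K \<omega> - (\<Sum>h=2..NG+1. B h \<omega>))"
    using Ksum by (intro Bochner_Integration.integral_cong) auto
  also have "\<dots> = (LINT \<omega>|M. of_bool (G \<omega> = 1) * K \<omega>) - (\<Sum>h=2..NG+1. LINT \<omega>|M. B h \<omega>)"
    using intK intB
    by (subst Bochner_Integration.integral_diff)
      (auto simp: Bochner_Integration.integral_sum simp del: sum.cl_ivl_Suc)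
  also have "(LINT \<omega>|M. of_bool (G \<omega> = 1) * K \<omega>) = (LINT \<omega>|M. effect \<omega>) + (LINT \<omega>|M. A \<omega>)"
    using integral_cong_AE[OF m K1] int_effect intA by simp
  finally show "(LINT \<omega>|M. K \<omega>) = (LINT \<omega>|M. of_bool (G \<omega> = 1) * (Y1 TT \<omega> - Y0 TT \<omega>))
      + (LINT \<omega>|M. of_bool (G \<omega> = 1) * (D \<omega> - c (X \<omega>)))
      - (\<Sum>h=2..NG+1. LINT \<omega>|M. of_bool (G \<omega> = h) * (a h (X \<omega>) * (D \<omega> - c (X \<omega>))))"
    by (simp add: effect_def A_def B_def)
qed

end

subsection \<open>Identification\<close>

text \<open>Two projections onto the covariate in succession: within the group, \<open>D\<close> is
  replaced by its conditional mean; then the group indicator is replaced by the propensity. What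
  remains is an integral of functions measurable with respect to \<open>F\<close>.\<close>

lemma group_residual:
  assumes h: "h \<in> {1..NG+1}"
    and f [measurable]: "f \<in> borel_measurable MX" and c [measurable]: "c \<in> borel_measurable MX"
    and int: "integrable M (\<lambda>\<omega>. of_bool (G \<omega> = h) * (f (X \<omega>) * (D \<omega> - c (X \<omega>))))"
  shows "integrable M (\<lambda>\<omega>. p h (X \<omega>) * (f (X \<omega>) * (\<Delta> h \<omega> - c (X \<omega>))))"
    and "(LINT \<omega>|M. of_bool (G \<omega> = h) * (f (X \<omega>) * (D \<omega> - c (X \<omega>)))) =
      (LINT \<omega>|M. p h (X \<omega>) * (f (X \<omega>) * (\<Delta> h \<omega> - c (X \<omega>))))"
proof -
  have Q: "Measurable.pred M (\<lambda>\<omega>. G \<omega> = h)" by measurable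
  have m: "(\<lambda>\<omega>. f (X \<omega>)) \<in> borel_measurable F" "(\<lambda>\<omega>. c (X \<omega>)) \<in> borel_measurable F"
    "(\<lambda>\<omega>. f (X \<omega>) * (\<Delta> h \<omega> - c (X \<omega>))) \<in> borel_measurable F"
    by measurable
  note residual = cexp_residual[OF Q group_prob_pos[OF h] D_int m(1,2) int]
  note weighting = propensity_weighting[OF Q p[OF h] m(3) residual(1)]
  show "integrable M (\<lambda>\<omega>. p h (X \<omega>) * (f (X \<omega>) * (\<Delta> h \<omega> - c (X \<omega>))))"
    by (rule weighting(1))
  show "(LINT \<omega>|M. of_bool (G \<omega> = h) * (f (X \<omega>) * (D \<omega> - c (X \<omega>)))) =
      (LINT \<omega>|M. p h (X \<omega>) * (f (X \<omega>) * (\<Delta> h \<omega> - c (X \<omega>))))"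
    using residual(2) weighting(2) by simp
qed

lemma p_measurable: "h \<in> {1..NG+1} \<Longrightarrow> p h \<in> borel_measurable MX"
  using p by (simp add: regression_fn_def)

lemma \<Delta>_measurable [measurable]: "\<Delta> h \<in> borel_measurable M"
  by (rule cexp_measurable)

text \<open>The factor \<open>p 1 / p h\<close> moves group \<open>h\<close> to the covariate distribution of group 1, where the
  weighted trends of the controls add up to the trend of group 1.\<close>

lemma balanced_if_true_propensity:
  fixes w :: "nat \<Rightarrow> 'x \<Rightarrow> real" and c :: "'x \<Rightarrow> real"
  defines "a \<equiv> \<lambda>h x. w h x * (p 1 x / p h x)"
  assumes w: "weight_fns M NG MX X w" and c [measurable]: "c \<in> borel_measurable MX"
    and trend: "AE \<omega> in M. \<Delta> 1 \<omega> = (\<Sum>h=2..NG+1. w h (X \<omega>) * \<Delta> h \<omega>)"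
    and int1: "integrable M (\<lambda>\<omega>. of_bool (G \<omega> = 1) * (D \<omega> - c (X \<omega>)))"
    and int: "\<And>h. h \<in> {2..NG+1} \<Longrightarrow>
      integrable M (\<lambda>\<omega>. of_bool (G \<omega> = h) * (a h (X \<omega>) * (D \<omega> - c (X \<omega>))))"
  shows "(LINT \<omega>|M. of_bool (G \<omega> = 1) * (D \<omega> - c (X \<omega>))) =
    (\<Sum>h=2..NG+1. LINT \<omega>|M. of_bool (G \<omega> = h) * (a h (X \<omega>) * (D \<omega> - c (X \<omega>))))"
proof -
  have [measurable]: "w h \<in> borel_measurable MX" if "h \<in> {2..NG+1}" for h
    using w that by (simp add: weight_fns_def)
  have [measurable]: "p 1 \<in> borel_measurable MX"
    by (rule p_measurable) simp
  have [measurable]: "p h \<in> borel_measurable MX" if "h \<in> {2..NG+1}" for h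
    using that by (intro p_measurable) simp
  have a [measurable]: "a h \<in> borel_measurable MX" if "h \<in> {2..NG+1}" for h
    using that unfolding a_def by measurable
  define B where "B = (\<lambda>h \<omega>. w h (X \<omega>) * (p 1 (X \<omega>) * (\<Delta> h \<omega> - c (X \<omega>))))"
  have B: "integrable M (B h)"
    "(LINT \<omega>|M. of_bool (G \<omega> = h) * (a h (X \<omega>) * (D \<omega> - c (X \<omega>)))) = (LINT \<omega>|M. B h \<omega>)"
    if h: "h \<in> {2..NG+1}" for h
  proof -
    have h': "h \<in> {1..NG+1}" using h by simp
    note * = group_residual[OF h' a[OF h] c int[OF h]]
    have "AE \<omega> in M. p h (X \<omega>) > 0"
      using overlap h' by (simp add: overlap_def)
    \<comment> \<open>The propensity from the projection cancels the denominator of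
      \<open>a h\<close>, which leaves \<open>p 1\<close>.\<close>
    then have ae: "AE \<omega> in M. p h (X \<omega>) * (a h (X \<omega>) * (\<Delta> h \<omega> - c (X \<omega>))) = B h \<omega>"
      by eventually_elim (simp add: a_def B_def)
    have m: "(\<lambda>\<omega>. p h (X \<omega>) * (a h (X \<omega>) * (\<Delta> h \<omega> - c (X \<omega>)))) \<in> borel_measurable M"
      "B h \<in> borel_measurable M"
      using h unfolding B_def by measurable
    show "integrable M (B h)"
      using *(1) integrable_cong_AE[OF m ae] by simp
    show "(LINT \<omega>|M. of_bool (G \<omega> = h) * (a h (X \<omega>) * (D \<omega> - c (X \<omega>)))) = (LINT \<omega>|M. B h \<omega>)"
      using *(2) integral_cong_AE[OF m ae] by simp
  qed
  have "(LINT \<omega>|M. of_bool (G \<omega> = 1) * (D \<omega> - c (X \<omega>))) =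
      (LINT \<omega>|M. p 1 (X \<omega>) * (\<Delta> 1 \<omega> - c (X \<omega>)))"
    using group_residual(2)[of 1 "\<lambda>_. 1" c] int1 by simp
  also have "\<dots> = (LINT \<omega>|M. (\<Sum>h=2..NG+1. B h \<omega>))"
  proof (rule integral_cong_AE)
    show "(\<lambda>\<omega>. \<Sum>h=2..NG+1. B h \<omega>) \<in> borel_measurable M"
      using B(1) by (intro borel_measurable_sum) auto
    have "AE \<omega> in M. (\<Sum>h=2..NG+1. w h (X \<omega>)) = 1"
      using w by (simp add: weight_fns_def)
    with trend show "AE \<omega> in M. p 1 (X \<omega>) * (\<Delta> 1 \<omega> - c (X \<omega>)) = (\<Sum>h=2..NG+1. B h \<omega>)"
    proof eventually_elim
      case (elim \<omega>)
      \<comment> \<open>Because the weights sum to one, the same \<open>c (X \<omega>)\<close> is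
        subtracted from the weighted control trend as from the trend of group 1, whatever
        \<open>c\<close> is.\<close>
      have "(\<Sum>h=2..NG+1. B h \<omega>) = p 1 (X \<omega>) *
          ((\<Sum>h=2..NG+1. w h (X \<omega>) * \<Delta> h \<omega>) - (\<Sum>h=2..NG+1. w h (X \<omega>)) * c (X \<omega>))"
        unfolding B_def sum_distrib_left sum_distrib_right sum_subtractf[symmetric]
        by (intro sum.cong) (simp_all add: algebra_simps)
      then show ?case using elim by (simp only: mult_1)
    qed
  qed measurable
  also have "\<dots> = (\<Sum>h=2..NG+1. LINT \<omega>|M. B h \<omega>)"
    using B(1) by (intro Bochner_Integration.integral_sum) auto
  also have "\<dots> = (\<Sum>h=2..NG+1. LINT \<omega>|M. of_bool (G \<omega> = h) * (a h (X \<omega>) * (D \<omega> - c (X \<omega>))))"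
    using B(2) by (intro sum.cong) auto
  finally show ?thesis .
qed

text \<open>Once \<open>D\<close> is replaced by \<open>\<Delta> h\<close>, a correct
  \<open>c\<close> makes the integrand vanish almost everywhere, for any factor \<open>f\<close>
  that keeps the residual integrable.\<close>

lemma residual_integral_zero:
  assumes h: "h \<in> {1..NG+1}"
    and f: "f \<in> borel_measurable MX" and c: "c \<in> borel_measurable MX"
    and int: "integrable M (\<lambda>\<omega>. of_bool (G \<omega> = h) * (f (X \<omega>) * (D \<omega> - c (X \<omega>))))"
    and true: "AE \<omega> in M. c (X \<omega>) = \<Delta> h \<omega>"
  shows "(LINT \<omega>|M. of_bool (G \<omega> = h) * (f (X \<omega>) * (D \<omega> - c (X \<omega>)))) = 0"
proof -
  have "AE \<omega> in M. p h (X \<omega>) * (f (X \<omega>) * (\<Delta> h \<omega> - c (X \<omega>))) = 0"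
    using true by eventually_elim simp
  then show ?thesis
    unfolding group_residual(2)[OF h f c int] by (rule integral_eq_zero_AE)
qed

section \<open>The trend of group 1 as a weighted trend of the controls\<close>

lemma trend_if_parallel_trends:
  assumes pt: "parallel_trends M NG TT G MX X Y0" and w: "weight_fns M NG MX X w"
  shows "AE \<omega> in M. \<Delta> 1 \<omega> = (\<Sum>h=2..NG+1. w h (X \<omega>) * \<Delta> h \<omega>)"
proof -
  have "AE \<omega> in M. \<forall>h\<in>{2..NG+1}. \<Delta> 1 \<omega> = \<Delta> h \<omega>"
    using pt by (intro AE_finite_allI) (auto simp: parallel_trends_def)
  moreover have "AE \<omega> in M. (\<Sum>h=2..NG+1. w h (X \<omega>)) = 1"
    using w by (simp add: weight_fns_def)
  ultimately show ?thesis
  proof eventually_elim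
    case (elim \<omega>)
    have "(\<Sum>h=2..NG+1. w h (X \<omega>) * \<Delta> h \<omega>) = (\<Sum>h=2..NG+1. w h (X \<omega>)) * \<Delta> 1 \<omega>"
      unfolding sum_distrib_right using elim(1) by (intro sum.cong) auto
    then show ?case using elim(2) by simp
  qed
qed

text \<open>Linearity of the conditional mean yields the equation only almost everywhere in group
  \<open>g\<close>; both sides depend on the covariate alone, so overlap extends it to the whole
  space.\<close>

lemma trend_eq_diff:
  assumes g: "g \<in> {1..NG+1}"
  shows "AE \<omega> in M. \<Delta> g \<omega> = cexp (given M (\<lambda>\<omega>. G \<omega> = g)) MX X (Y0 TT) \<omega>
    - cexp (given M (\<lambda>\<omega>. G \<omega> = g)) MX X (Y0 (TT - 1)) \<omega>"
proof (rule AE_eq_if_AE_eq_group[OF g])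
  have Q: "Measurable.pred M (\<lambda>\<omega>. G \<omega> = g)" by measurable
  note pos = group_prob_pos[OF g]
  interpret S: sigma_finite_subalgebra "given M (\<lambda>\<omega>. G \<omega> = g)" F
    by (rule sigma_finite_subalgebra_given[OF Q pos])
  show "AE \<omega> in M. G \<omega> = g \<longrightarrow> \<Delta> g \<omega> = cexp (given M (\<lambda>\<omega>. G \<omega> = g)) MX X (Y0 TT) \<omega>
      - cexp (given M (\<lambda>\<omega>. G \<omega> = g)) MX X (Y0 (TT - 1)) \<omega>"
    unfolding AE_given[OF Q pos, symmetric] cexp_given
    using last_periods by (intro S.real_cond_exp_diff integrable_givenI[OF Q pos] Y0_int) auto
qed measurable

text \<open>The synthetic control equation in levels is taken at \<open>TT\<close> and at
  \<open>TT - 1\<close>, and the two are subtracted.\<close>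

lemma trend_if_synthetic_control:
  assumes sc: "synthetic_control M NG TT G MX X Y0 w"
  shows "AE \<omega> in M. \<Delta> 1 \<omega> = (\<Sum>h=2..NG+1. w h (X \<omega>) * \<Delta> h \<omega>)"
proof -
  let ?m = "\<lambda>g t. cexp (given M (\<lambda>\<omega>. G \<omega> = g)) MX X (Y0 t)"
  have "AE \<omega> in M. \<forall>g\<in>{1..NG+1}. \<Delta> g \<omega> = ?m g TT \<omega> - ?m g (TT - 1) \<omega>"
    using trend_eq_diff by (intro AE_finite_allI) auto
  moreover have "AE \<omega> in M. ?m 1 TT \<omega> = (\<Sum>h=2..NG+1. w h (X \<omega>) * ?m h TT \<omega>)"
      "AE \<omega> in M. ?m 1 (TT - 1) \<omega> = (\<Sum>h=2..NG+1. w h (X \<omega>) * ?m h (TT - 1) \<omega>)"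
    using sc last_periods unfolding synthetic_control_def by blast+
  ultimately show ?thesis
  proof eventually_elim
    case (elim \<omega>)
    have "(\<Sum>h=2..NG+1. w h (X \<omega>) * \<Delta> h \<omega>) =
        (\<Sum>h=2..NG+1. w h (X \<omega>) * ?m h TT \<omega> - w h (X \<omega>) * ?m h (TT - 1) \<omega>)"
      using elim(1) by (intro sum.cong) (auto simp: right_diff_distrib)
    also have "\<dots> = ?m 1 TT \<omega> - ?m 1 (TT - 1) \<omega>"
      unfolding sum_subtractf elim(2,3) ..
    also have "\<dots> = \<Delta> 1 \<omega>"
      using elim(1) by simp
    finally show ?case ..
  qed
qed

section \<open>The outcome regression of the pooled controls\<close>

text \<open>Time invariance turns the regression of the sampled outcome into \<open>lam t\<close>
  times the mean of \<open>Y0 t\<close> among all controls, so the scaled difference is the pooled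
  control trend. Parallel trends makes every control trend equal to that of group 1, hence the
  pooled one too.\<close>

lemma outcome_regression_eq_trend:
  fixes mu :: "nat \<Rightarrow> 'x \<Rightarrow> real"
  assumes pt: "parallel_trends M NG TT G MX X Y0" and NG: "NG \<ge> 1"
    and mu: "\<And>t. t \<in> {1..TT} \<Longrightarrow>
       regression_fn (given M (\<lambda>\<omega>. G \<omega> \<noteq> 1)) MX X
         (\<lambda>\<omega>. of_bool (T \<omega> = t) * observed TT G T Y0 Y1 \<omega>) (mu t)"
  shows "AE \<omega> in M. mu TT (X \<omega>) / lam TT - mu (TT - 1) (X \<omega>) / lam (TT - 1) = \<Delta> 1 \<omega>"
proof -
  let ?Q = "\<lambda>\<omega>. G \<omega> \<noteq> 1"
  have two: "2 \<in> {1..NG+1}" using NG by simp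
  have Q: "Measurable.pred M ?Q" by measurable
  \<comment> \<open>Group 2 is a control group, and overlap gives it positive probability.\<close>
  have "\<P>(\<omega> in M. G \<omega> = 2) \<le> \<P>(\<omega> in M. ?Q \<omega>)"
    by (intro finite_measure_mono) auto
  then have pos: "\<P>(\<omega> in M. ?Q \<omega>) > 0"
    using group_prob_pos[OF two] by linarith
  interpret S: sigma_finite_subalgebra "given M ?Q" F
    by (rule sigma_finite_subalgebra_given[OF Q pos])
  have F_sets: "A \<in> sets M" if "A \<in> sets F" for A
    using subalgebra_F that by (auto simp: subalgebra_def)
  have Y0_given: "integrable (given M ?Q) (Y0 t)" if "t \<in> {1..TT}" for t
    by (rule integrable_givenI[OF Q pos Y0_int[OF that]])
  have mu_eq: "AE \<omega> in given M ?Q. mu t (X \<omega>) = lam t * cexp (given M ?Q) MX X (Y0 t) \<omega>"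
    if t: "t \<in> {1..TT}" for t
  proof -
    have [measurable]: "Y0 t \<in> borel_measurable M"
      using Y0_int[OF t] by simp
    let ?V = "\<lambda>\<omega>. of_bool (T \<omega> = t) * observed TT G T Y0 Y1 \<omega>"
    have V: "?Q \<omega> \<Longrightarrow> ?V \<omega> = of_bool (T \<omega> = t) * Y0 t \<omega>" for \<omega>
      using observed_eq[OF t] by (auto simp: realized_def)
    have V_eq: "?V = (\<lambda>\<omega>. of_bool (T \<omega> = t) * R t \<omega>)"
      using observed_eq[OF t] by (intro ext) auto
    have V_meas: "?V \<in> borel_measurable M"
      unfolding V_eq using realized_measurable[OF t] by measurable
    \<comment> \<open>Among the controls only untreated outcomes are observed, so
      \<open>Y0 t\<close> is an integrable bound.\<close>
    have "integrable M (\<lambda>\<omega>. of_bool (?Q \<omega>) * ?V \<omega>)"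
    proof (rule Bochner_Integration.integrable_bound[OF Y0_int[OF t]])
      show "(\<lambda>\<omega>. of_bool (?Q \<omega>) * ?V \<omega>) \<in> borel_measurable M"
        using V_meas by measurable
    qed (use V in auto)
    then have V_int: "integrable (given M ?Q) ?V"
      by (subst integrable_given[OF Q pos V_meas])
    have "AE \<omega> in given M ?Q. real_cond_exp (given M ?Q) F ?V \<omega> = lam t * cexp (given M ?Q) MX X (Y0 t) \<omega>"
    proof (rule S.real_cond_exp_charact[OF _ V_int])
      show "integrable (given M ?Q) (\<lambda>\<omega>. lam t * cexp (given M ?Q) MX X (Y0 t) \<omega>)"
        unfolding cexp_given
        using S.real_cond_exp_int(1)[OF Y0_given[OF t]] by (rule integrable_mult_right)
      show "(\<lambda>\<omega>. lam t * cexp (given M ?Q) MX X (Y0 t) \<omega>) \<in> borel_measurable F"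
        by measurable
      fix A assume A: "A \<in> sets F"
      note [measurable] = F_sets[OF A]
      define Z where "Z = (\<lambda>\<omega>. of_bool (?Q \<omega>) * indicator A \<omega> * R t \<omega>)"
      \<comment> \<open>Writing \<open>A\<close> as a preimage under \<open>X\<close> turns its
        indicator into a function of \<open>X\<close>, which makes \<open>Z\<close> measurable with
        respect to \<open>H\<close>.\<close>
      obtain C where C: "C \<in> sets MX" "A = X -` C \<inter> space M"
        using A measurable_space[OF X_meas] by (subst (asm) sets_vimage_algebra2) auto
      have "(\<lambda>\<omega>. of_bool (?Q \<omega>) * indicator C (X \<omega>) * R t \<omega>) \<in> borel_measurable H"
        using C(1) realized_H_measurable[OF t] by measurable
      also have "?this \<longleftrightarrow> Z \<in> borel_measurable H"
        by (intro measurable_cong) (auto simp: Z_def C(2) indicator_def)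
      finally have Z_meas: "Z \<in> borel_measurable H" .
      have "integrable M (\<lambda>\<omega>. of_bool (T \<omega> = t) * Z \<omega>)"
      proof (rule Bochner_Integration.integrable_bound[OF Y0_int[OF t]])
        show "(\<lambda>\<omega>. of_bool (T \<omega> = t) * Z \<omega>) \<in> borel_measurable M"
          using realized_measurable[OF t] unfolding Z_def by measurable
      qed (auto simp: Z_def realized_def indicator_def)
      note period = integral_sampling_period[OF Z_meas t this]
      have "(LINT \<omega>:A|given M ?Q. ?V \<omega>) =
          (LINT \<omega>|M. of_bool (?Q \<omega>) * (indicator A \<omega> * ?V \<omega>)) / \<P>(\<omega> in M. ?Q \<omega>)"
        unfolding set_lebesgue_integral_def real_scaleR_def
        by (intro integral_given[OF Q pos] borel_measurable_times borel_measurable_indicator V_meas F_sets A)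
      also have "(LINT \<omega>|M. of_bool (?Q \<omega>) * (indicator A \<omega> * ?V \<omega>)) =
          (LINT \<omega>|M. of_bool (T \<omega> = t) * Z \<omega>)"
        by (intro Bochner_Integration.integral_cong) (auto simp: Z_def observed_eq[OF t])
      also have "\<dots> = lam t * (LINT \<omega>|M. of_bool (?Q \<omega>) * (indicator A \<omega> * Y0 t \<omega>))"
        unfolding period(2) by (intro arg_cong2[where f = "(*)"] Bochner_Integration.integral_cong)
          (auto simp: Z_def realized_def)
      also have "\<dots> / \<P>(\<omega> in M. ?Q \<omega>) = lam t * (LINT \<omega>:A|given M ?Q. Y0 t \<omega>)"
        by (simp add: set_lebesgue_integral_def integral_given[OF Q pos] del: One_nat_def)
      also have "\<dots> = lam t * (LINT \<omega>:A|given M ?Q. cexp (given M ?Q) MX X (Y0 t) \<omega>)"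
        using S.real_cond_exp_intA[OF Y0_given[OF t] A] by (simp add: cexp_given)
      also have "\<dots> = (LINT \<omega>:A|given M ?Q. lam t * cexp (given M ?Q) MX X (Y0 t) \<omega>)"
        by simp
      finally show "(LINT \<omega>:A|given M ?Q. ?V \<omega>) =
          (LINT \<omega>:A|given M ?Q. lam t * cexp (given M ?Q) MX X (Y0 t) \<omega>)" .
    qed
    moreover have "AE \<omega> in given M ?Q. mu t (X \<omega>) = real_cond_exp (given M ?Q) F ?V \<omega>"
      using mu[OF t] unfolding regression_fn_def cexp_given by (rule conjunct2)
    ultimately show ?thesis by eventually_elim simp
  qed
  have D_given: "integrable (given M ?Q) D"
    by (rule integrable_givenI[OF Q pos D_int])
  have all_eq: "AE \<omega> in M. \<Delta> 1 \<omega> = \<Delta> h \<omega>" if "h \<in> {2..NG+1}" for h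
    using pt that by (auto simp: parallel_trends_def)
  have [measurable]: "D \<in> borel_measurable M" using D_int by (rule borel_measurable_integrable)
  have group: "integrable M (\<lambda>\<omega>. of_bool (G \<omega> = h) * (indicator A \<omega> * \<Delta> 1 \<omega>))"
    "(LINT \<omega>|M. of_bool (G \<omega> = h) * (indicator A \<omega> * D \<omega>)) =
      (LINT \<omega>|M. of_bool (G \<omega> = h) * (indicator A \<omega> * \<Delta> 1 \<omega>))"
    "integrable M (\<lambda>\<omega>. of_bool (G \<omega> = h) * (indicator A \<omega> * D \<omega>))"
    if h: "h \<in> {2..NG+1}" and A: "A \<in> sets F" for h A
  proof -
    note [measurable] = F_sets[OF A]
    have Qh: "Measurable.pred M (\<lambda>\<omega>. G \<omega> = h)" by measurable
    have h': "h \<in> {1..NG+1}" using h by simp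
    show int: "integrable M (\<lambda>\<omega>. of_bool (G \<omega> = h) * (indicator A \<omega> * D \<omega>))"
      by (rule Bochner_Integration.integrable_bound[OF D_int]) (measurable, auto simp: indicator_def)
    have ind: "indicator A \<in> borel_measurable F" using A by simp
    \<comment> \<open>The residual lemma with weight \<open>indicator A\<close> and
      \<open>c = 0\<close> is the defining property of the conditional mean of \<open>D\<close>
      within group \<open>h\<close>.\<close>
    note * = cexp_residual[OF Qh group_prob_pos[OF h'] D_int ind, of "\<lambda>_. 0",
        unfolded diff_0_right, OF borel_measurable_const int]
    have ae: "AE \<omega> in M. of_bool (G \<omega> = h) * (indicator A \<omega> * \<Delta> h \<omega>) =
        of_bool (G \<omega> = h) * (indicator A \<omega> * \<Delta> 1 \<omega>)"
      using all_eq[OF h] by eventually_elim simp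
    have m: "(\<lambda>\<omega>. of_bool (G \<omega> = h) * (indicator A \<omega> * \<Delta> h \<omega>)) \<in> borel_measurable M"
        "(\<lambda>\<omega>. of_bool (G \<omega> = h) * (indicator A \<omega> * \<Delta> 1 \<omega>)) \<in> borel_measurable M"
      by measurable
    show "integrable M (\<lambda>\<omega>. of_bool (G \<omega> = h) * (indicator A \<omega> * \<Delta> 1 \<omega>))"
      using *(1) integrable_cong_AE[OF m ae] by simp
    show "(LINT \<omega>|M. of_bool (G \<omega> = h) * (indicator A \<omega> * D \<omega>)) =
        (LINT \<omega>|M. of_bool (G \<omega> = h) * (indicator A \<omega> * \<Delta> 1 \<omega>))"
      using *(2) integral_cong_AE[OF m ae] by simp
  qed
  have controls: "of_bool (?Q \<omega>) = (\<Sum>h=2..NG+1. of_bool (G \<omega> = h) :: real)"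
    if "\<omega> \<in> space M" for \<omega>
    using G_range[OF that] by (auto simp: of_bool_def)
  have split: "(LINT \<omega>|M. of_bool (?Q \<omega>) * k \<omega>) = (\<Sum>h=2..NG+1. LINT \<omega>|M. of_bool (G \<omega> = h) * k \<omega>)"
      "integrable M (\<lambda>\<omega>. of_bool (?Q \<omega>) * k \<omega>)"
    if "\<And>h. h \<in> {2..NG+1} \<Longrightarrow> integrable M (\<lambda>\<omega>. of_bool (G \<omega> = h) * k \<omega>)" for k :: "'a \<Rightarrow> real"
  proof -
    have eq: "of_bool (?Q \<omega>) * k \<omega> = (\<Sum>h=2..NG+1. of_bool (G \<omega> = h) * k \<omega>)" if "\<omega> \<in> space M" for \<omega>
      unfolding controls[OF that] by (rule sum_distrib_right)
    have "(LINT \<omega>|M. of_bool (?Q \<omega>) * k \<omega>) = (LINT \<omega>|M. (\<Sum>h=2..NG+1. of_bool (G \<omega> = h) * k \<omega>))"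
      by (intro Bochner_Integration.integral_cong eq) auto
    also have "\<dots> = (\<Sum>h=2..NG+1. LINT \<omega>|M. of_bool (G \<omega> = h) * k \<omega>)"
      using that by (rule Bochner_Integration.integral_sum)
    finally show "(LINT \<omega>|M. of_bool (?Q \<omega>) * k \<omega>) = (\<Sum>h=2..NG+1. LINT \<omega>|M. of_bool (G \<omega> = h) * k \<omega>)" .
    have "integrable M (\<lambda>\<omega>. (\<Sum>h=2..NG+1. of_bool (G \<omega> = h) * k \<omega>))"
      using that by (rule Bochner_Integration.integrable_sum)
    then show "integrable M (\<lambda>\<omega>. of_bool (?Q \<omega>) * k \<omega>)"
      by (rule Bochner_Integration.integrable_cong[THEN iffD1, rotated -1]) (simp_all only: eq)
  qed
  \<comment> \<open>The pooled conditional mean is identified by its integrals over sets of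
    \<open>F\<close>: these split into control groups, and in each group \<open>\<Delta> 1\<close>
    has the same integral as \<open>D\<close>.\<close>
  have trend: "AE \<omega> in given M ?Q. real_cond_exp (given M ?Q) F D \<omega> = \<Delta> 1 \<omega>"
  proof (rule S.real_cond_exp_charact[OF _ D_given])
    have "integrable M (\<lambda>\<omega>. of_bool (?Q \<omega>) * (indicator (space M) \<omega> * \<Delta> 1 \<omega>))"
      by (rule split(2)[OF group(1)]) (auto intro: sets.top[of F, simplified])
    then have "integrable M (\<lambda>\<omega>. of_bool (?Q \<omega>) * \<Delta> 1 \<omega>)"
      by (rule Bochner_Integration.integrable_cong[THEN iffD1, rotated -1]) auto
    then show "integrable (given M ?Q) (\<Delta> 1)"
      by (subst integrable_given[OF Q pos]) measurable
    show "\<Delta> 1 \<in> borel_measurable F" by measurable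
    fix A assume A: "A \<in> sets F"
    note [measurable] = F_sets[OF A]
    have "(LINT \<omega>|M. of_bool (?Q \<omega>) * (indicator A \<omega> * D \<omega>)) =
        (LINT \<omega>|M. of_bool (?Q \<omega>) * (indicator A \<omega> * \<Delta> 1 \<omega>))"
      by (intro trans[OF split(1)] trans[OF sum.cong split(1)[symmetric]] refl group[OF _ A])
    then show "(LINT \<omega>:A|given M ?Q. D \<omega>) = (LINT \<omega>:A|given M ?Q. \<Delta> 1 \<omega>)"
      by (simp add: set_lebesgue_integral_def integral_given[OF Q pos] del: One_nat_def)
  qed
  have "AE \<omega> in given M ?Q. real_cond_exp (given M ?Q) F D \<omega> =
      cexp (given M ?Q) MX X (Y0 TT) \<omega> - cexp (given M ?Q) MX X (Y0 (TT - 1)) \<omega>"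
    unfolding cexp_given using last_periods by (intro S.real_cond_exp_diff Y0_given) auto
  with trend mu_eq[OF last_periods(1)] mu_eq[OF last_periods(2)]
  have "AE \<omega> in given M ?Q. mu TT (X \<omega>) / lam TT - mu (TT - 1) (X \<omega>) / lam (TT - 1) = \<Delta> 1 \<omega>"
  proof eventually_elim
    case (elim \<omega>)
    then show ?case
      using lam_pos[OF last_periods(1)] lam_pos[OF last_periods(2)] by simp
  qed
  then have "AE \<omega> in M. ?Q \<omega> \<longrightarrow> mu TT (X \<omega>) / lam TT - mu (TT - 1) (X \<omega>) / lam (TT - 1) = \<Delta> 1 \<omega>"
    by (subst (asm) AE_given[OF Q pos])
  \<comment> \<open>Overlap extends an equation between functions of the covariate from a single
    group to the whole space; group 2 serves as that group.\<close>
  then have "AE \<omega> in M. G \<omega> = 2 \<longrightarrow> mu TT (X \<omega>) / lam TT - mu (TT - 1) (X \<omega>) / lam (TT - 1) = \<Delta> 1 \<omega>"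
    by eventually_elim auto
  moreover have [measurable]: "mu TT \<in> borel_measurable MX" "mu (TT - 1) \<in> borel_measurable MX"
    using mu last_periods by (auto simp: regression_fn_def)
  ultimately show ?thesis
    by (intro AE_eq_if_AE_eq_group[OF two]) measurable
qed

section \<open>From the moment function to the effect\<close>

text \<open>Reduces all three identification claims to \<open>balanced\<close>: the mean residual of
  group 1 equals the sum of the weighted residuals of the controls. Integrability of the residuals
  appears as premises of \<open>balanced\<close> because it is only derived in the proof, from that
  of the whole moment.\<close>

lemma integral_phi_rc:
  fixes q w :: "nat \<Rightarrow> 'x \<Rightarrow> real" and mT mT1 :: "'x \<Rightarrow> real"
  defines "\<psi> \<equiv> \<lambda>\<omega>. phi_rc NG TT (S_rc TT G T X Y0 Y1 \<omega>) mT mT1 q w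
      (\<P>(\<omega> in M. G \<omega> = 1)) (lam TT) (lam (TT - 1))"
    and "c \<equiv> \<lambda>x. mT x / lam TT - mT1 x / lam (TT - 1)"
    and "a \<equiv> \<lambda>h x. w h x * (q 1 x / q h x)"
  assumes int: "integrable M \<psi>"
    and q: "\<And>h. h \<in> {1..NG+1} \<Longrightarrow> q h \<in> borel_measurable MX"
    and w: "weight_fns M NG MX X w"
    and [measurable]: "mT \<in> borel_measurable MX" "mT1 \<in> borel_measurable MX"
    and balanced: "integrable M (\<lambda>\<omega>. of_bool (G \<omega> = 1) * (D \<omega> - c (X \<omega>))) \<Longrightarrow>
      (\<And>h. h \<in> {2..NG+1} \<Longrightarrow>
        integrable M (\<lambda>\<omega>. of_bool (G \<omega> = h) * (a h (X \<omega>) * (D \<omega> - c (X \<omega>))))) \<Longrightarrow>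
      (LINT \<omega>|M. of_bool (G \<omega> = 1) * (D \<omega> - c (X \<omega>))) =
        (\<Sum>h=2..NG+1. LINT \<omega>|M. of_bool (G \<omega> = h) * (a h (X \<omega>) * (D \<omega> - c (X \<omega>))))"
  shows "(LINT \<omega>|M. \<psi> \<omega>) = (LINT \<omega>|given M (\<lambda>\<omega>. G \<omega> = 1). Y1 TT \<omega> - Y0 TT \<omega>)"
proof -
  let ?pi = "\<P>(\<omega> in M. G \<omega> = 1)"
  have pi: "?pi > 0" by (rule group_prob_pos) simp
  have [measurable]: "q 1 \<in> borel_measurable MX" by (rule q) simp
  have a [measurable]: "a h \<in> borel_measurable MX" if "h \<in> {2..NG+1}" for h
  proof -
    have [measurable]: "q h \<in> borel_measurable MX" "w h \<in> borel_measurable MX"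
      using that q w by (simp_all add: weight_fns_def)
    show ?thesis unfolding a_def by measurable
  qed
  have c [measurable]: "c \<in> borel_measurable MX" unfolding c_def by measurable
  define \<xi> where "\<xi> = (\<lambda>\<omega>. group_weight a \<omega> * ((of_bool (T \<omega> = TT) / lam TT - of_bool (T \<omega> = TT - 1) / lam (TT - 1))
      * observed TT G T Y0 Y1 \<omega> - c (X \<omega>)))"
  have \<psi>: "\<psi> = (\<lambda>\<omega>. (1 / ?pi) * \<xi> \<omega>)"
    unfolding \<psi>_def \<xi>_def S_rc_def phi_rc.simps group_weight_def a_def c_def by (simp add: mult.assoc)
  have int_\<xi>: "integrable M \<xi>"
    using int pi unfolding \<psi> by (subst (asm) integrable_mult_left_iff) auto
  note panel = moment_panel[OF a c int_\<xi>[unfolded \<xi>_def]]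
  note groups = panel_moment_groups[OF a c panel(1)]
  have [measurable]: "Y0 TT \<in> borel_measurable M" "Y1 TT \<in> borel_measurable M"
    using Y0_int Y1_meas last_periods by auto
  have "(LINT \<omega>|M. \<psi> \<omega>) = (LINT \<omega>|M. \<xi> \<omega>) / ?pi"
    unfolding \<psi> by simp
  also have "(LINT \<omega>|M. \<xi> \<omega>) = (LINT \<omega>|M. of_bool (G \<omega> = 1) * (Y1 TT \<omega> - Y0 TT \<omega>))"
    using panel(2) groups(3) balanced[OF groups(1,2)] unfolding \<xi>_def by linarith
  also have "\<dots> / ?pi = (LINT \<omega>|given M (\<lambda>\<omega>. G \<omega> = 1). Y1 TT \<omega> - Y0 TT \<omega>)"
    using pi by (subst integral_given) auto
  finally show ?thesis .
qed

end

theorem corollary5: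
  fixes M :: "'a measure" and N :: "'b measure" and MX :: "'x measure"
    and NG TT n :: nat
    and G T :: "'a \<Rightarrow> nat" and X :: "'a \<Rightarrow> 'x"
    and Y0 Y1 :: "nat \<Rightarrow> 'a \<Rightarrow> real"
    and S :: "nat \<Rightarrow> 'b \<Rightarrow> real \<times> nat \<times> nat \<times> 'x"
    and p mu :: "nat \<Rightarrow> 'x \<Rightarrow> real"
    and \<theta> \<pi>1 :: real and lam :: "nat \<Rightarrow> real"
    and \<phi> :: "('x \<Rightarrow> real) \<Rightarrow> ('x \<Rightarrow> real) \<Rightarrow> (nat \<Rightarrow> 'x \<Rightarrow> real) \<Rightarrow> (nat \<Rightarrow> 'x \<Rightarrow> real) \<Rightarrow> 'a \<Rightarrow> real"
  assumes "prob_space M"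
    and "TT \<ge> 2"
    and "G \<in> measurable M (count_space UNIV)" and "\<And>\<omega>. \<omega> \<in> space M \<Longrightarrow> G \<omega> \<in> {1..NG+1}"
    and "T \<in> measurable M (count_space UNIV)" and "\<And>\<omega>. \<omega> \<in> space M \<Longrightarrow> T \<omega> \<in> {1..TT}"
    and "X \<in> measurable M MX"
    and "\<And>t. t \<in> {1..TT} \<Longrightarrow> Y0 t \<in> borel_measurable M"
    and "\<And>t. t \<in> {1..TT} \<Longrightarrow> Y1 t \<in> borel_measurable M"
    and "\<And>t. t \<in> {1..TT} \<Longrightarrow> integrable M (Y0 t)"
    and "set_integrable M {\<omega> \<in> space M. G \<omega> = 1} (Y1 TT)"
    and p: "\<And>g. g \<in> {1..NG+1} \<Longrightarrow> regression_fn M MX X (\<lambda>\<omega>. of_bool (G \<omega> = g)) (p g)"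
    and mu: "\<And>t. t \<in> {1..TT} \<Longrightarrow>
       regression_fn (given M (\<lambda>\<omega>. G \<omega> \<noteq> 1)) MX X
         (\<lambda>\<omega>. of_bool (T \<omega> = t) * observed TT G T Y0 Y1 \<omega>) (mu t)"
    and "\<pi>1 = \<P>(\<omega> in M. G \<omega> = 1)"
    and "\<And>t. t \<in> {1..TT} \<Longrightarrow> lam t = \<P>(\<omega> in M. T \<omega> = t)"
    and "no_anticipation M TT Y0 Y1"
    and "overlap M NG X p"
    and "iid_sample N n S M MX (S_rc TT G T X Y0 Y1)"
    and "time_invariance M TT G T MX X Y0 Y1"
    and theta: "\<theta> = (LINT \<omega>|given M (\<lambda>\<omega>. G \<omega> = 1). Y1 TT \<omega> - Y0 TT \<omega>)"
    and phi: "\<And>mT mT1 q v \<omega>. \<phi> mT mT1 q v \<omega> =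
       phi_rc NG TT (S_rc TT G T X Y0 Y1 \<omega>) mT mT1 q v \<pi>1 (lam TT) (lam (TT-1))"
  shows "(parallel_trends M NG TT G MX X Y0 \<longrightarrow>
           (\<forall>w'. weight_fns M NG MX X w' \<longrightarrow>
              (\<forall>p'. (\<forall>g\<in>{1..NG+1}. p' g \<in> borel_measurable MX \<and> (AE \<omega> in M. p' g (X \<omega>) \<noteq> 0)) \<longrightarrow>
                 integrable M (\<phi> (mu TT) (mu (TT-1)) p' w') \<longrightarrow>
                 \<theta> = (LINT \<omega>|M. \<phi> (mu TT) (mu (TT-1)) p' w' \<omega>)) \<and>
              (\<forall>mT' mT1'. mT' \<in> borel_measurable MX \<longrightarrow> mT1' \<in> borel_measurable MX \<longrightarrow>
                 integrable M (\<phi> mT' mT1' p w') \<longrightarrow>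
                 \<theta> = (LINT \<omega>|M. \<phi> mT' mT1' p w' \<omega>)))) \<and>
         (\<forall>w. synthetic_control M NG TT G MX X Y0 w \<longrightarrow>
              (\<forall>mT' mT1'. mT' \<in> borel_measurable MX \<longrightarrow> mT1' \<in> borel_measurable MX \<longrightarrow>
                 integrable M (\<phi> mT' mT1' p w) \<longrightarrow>
                 \<theta> = (LINT \<omega>|M. \<phi> mT' mT1' p w \<omega>)))"
proof -
  interpret prob_space M by fact
  interpret repeated_cross_sections M MX X NG TT G T Y0 Y1 p lam
    by unfold_locales (fact assms)+
  have \<pi>1: "\<pi>1 = \<P>(\<omega> in M. G \<omega> = 1)" by fact
  have \<phi>: "\<phi> mT mT1 q v = (\<lambda>\<omega>. phi_rc NG TT (S_rc TT G T X Y0 Y1 \<omega>) mT mT1 q v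
      (\<P>(\<omega> in M. G \<omega> = 1)) (lam TT) (lam (TT - 1)))" for mT mT1 q v
    by (intro ext) (simp only: phi \<pi>1)
  \<comment> \<open>With the true propensities only the trend equation matters, so this covers both
    the second claim under parallel trends and the claim under synthetic control.\<close>
  have true_propensity: "\<theta> = (LINT \<omega>|M. \<phi> mT mT1 p w \<omega>)"
    if w: "weight_fns M NG MX X w"
      and trend: "AE \<omega> in M. \<Delta> 1 \<omega> = (\<Sum>h=2..NG+1. w h (X \<omega>) * \<Delta> h \<omega>)"
      and [measurable]: "mT \<in> borel_measurable MX" "mT1 \<in> borel_measurable MX"
      and int: "integrable M (\<phi> mT mT1 p w)" for mT mT1 w
  proof -
    have c: "(\<lambda>x. mT x / lam TT - mT1 x / lam (TT - 1)) \<in> borel_measurable MX" by measurable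
    show ?thesis
      unfolding theta \<phi>
      by (rule integral_phi_rc[OF int[unfolded \<phi>] p_measurable w that(3,4)
            balanced_if_true_propensity[OF w c trend], symmetric])
  qed
  have true_regression: "\<theta> = (LINT \<omega>|M. \<phi> (mu TT) (mu (TT - 1)) q w \<omega>)"
    if pt: "parallel_trends M NG TT G MX X Y0" and w: "weight_fns M NG MX X w"
      and q: "\<And>h. h \<in> {1..NG+1} \<Longrightarrow> q h \<in> borel_measurable MX"
      and int: "integrable M (\<phi> (mu TT) (mu (TT - 1)) q w)" for q w
  proof -
    let ?c = "\<lambda>x. mu TT x / lam TT - mu (TT - 1) x / lam (TT - 1)"
    have mu_meas [measurable]: "mu TT \<in> borel_measurable MX" "mu (TT - 1) \<in> borel_measurable MX"
      using mu last_periods by (auto simp: regression_fn_def)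
    have c: "?c \<in> borel_measurable MX" by measurable
    \<comment> \<open>Without control groups the sum of the weights would be empty, hence 0 rather
      than 1.\<close>
    have "NG \<noteq> 0"
    proof
      assume "NG = 0"
      then have "AE \<omega> in M. False" using w by (simp add: weight_fns_def)
      then show False by simp
    qed
    then have "AE \<omega> in M. ?c (X \<omega>) = \<Delta> 1 \<omega>"
      by (intro outcome_regression_eq_trend[OF pt _ mu]) auto
    \<comment> \<open>Under parallel trends the one regression difference is the correct trend for
      every group, so each residual has mean zero separately.\<close>
    then have true: "AE \<omega> in M. ?c (X \<omega>) = \<Delta> h \<omega>" if "h \<in> {1..NG+1}" for h
    proof (cases "h = 1")
      case False
      then have "AE \<omega> in M. \<Delta> 1 \<omega> = \<Delta> h \<omega>"
        using that pt by (auto simp: parallel_trends_def)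
      with \<open>AE \<omega> in M. ?c (X \<omega>) = \<Delta> 1 \<omega>\<close> show ?thesis by eventually_elim simp
    qed simp
    have q1: "q 1 \<in> borel_measurable MX" by (rule q) simp
    have a: "(\<lambda>x. w h x * (q 1 x / q h x)) \<in> borel_measurable MX" if "h \<in> {2..NG+1}" for h
    proof -
      have [measurable]: "q h \<in> borel_measurable MX" "w h \<in> borel_measurable MX"
        using that q w by (simp_all add: weight_fns_def)
      show ?thesis using q1 by measurable
    qed
    show ?thesis
      unfolding theta \<phi>
    proof (rule integral_phi_rc[OF int[unfolded \<phi>] q w mu_meas, symmetric])
      assume int1: "integrable M (\<lambda>\<omega>. of_bool (G \<omega> = 1) * (D \<omega> - ?c (X \<omega>)))"
        and inth: "\<And>h. h \<in> {2..NG+1} \<Longrightarrow> integrable M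
          (\<lambda>\<omega>. of_bool (G \<omega> = h) * (w h (X \<omega>) * (q 1 (X \<omega>) / q h (X \<omega>)) * (D \<omega> - ?c (X \<omega>))))"
      have "(LINT \<omega>|M. of_bool (G \<omega> = 1) * (D \<omega> - ?c (X \<omega>))) = 0"
        using residual_integral_zero[of 1 "\<lambda>_. 1" ?c] int1 c true[of 1] by simp
      moreover have "(LINT \<omega>|M. of_bool (G \<omega> = h) *
          (w h (X \<omega>) * (q 1 (X \<omega>) / q h (X \<omega>)) * (D \<omega> - ?c (X \<omega>)))) = 0"
        if h: "h \<in> {2..NG+1}" for h
        using h by (intro residual_integral_zero[OF _ a[OF h] c inth[OF h] true]) auto
      then have "(\<Sum>h=2..NG+1. LINT \<omega>|M. of_bool (G \<omega> = h) *
          (w h (X \<omega>) * (q 1 (X \<omega>) / q h (X \<omega>)) * (D \<omega> - ?c (X \<omega>)))) = 0"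
        by (intro sum.neutral) auto
      ultimately show "(LINT \<omega>|M. of_bool (G \<omega> = 1) * (D \<omega> - ?c (X \<omega>))) =
          (\<Sum>h=2..NG+1. LINT \<omega>|M. of_bool (G \<omega> = h) *
            (w h (X \<omega>) * (q 1 (X \<omega>) / q h (X \<omega>)) * (D \<omega> - ?c (X \<omega>))))"
        by simp
    qed
  qed
  have "\<theta> = (LINT \<omega>|M. \<phi> mT mT1 p w \<omega>)"
    if "parallel_trends M NG TT G MX X Y0" "weight_fns M NG MX X w"
      "mT \<in> borel_measurable MX" "mT1 \<in> borel_measurable MX" "integrable M (\<phi> mT mT1 p w)" for mT mT1 w
    by (rule true_propensity[OF that(2) trend_if_parallel_trends[OF that(1,2)] that(3-5)])
  moreover have "\<theta> = (LINT \<omega>|M. \<phi> mT mT1 p w \<omega>)"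
    if "synthetic_control M NG TT G MX X Y0 w"
      "mT \<in> borel_measurable MX" "mT1 \<in> borel_measurable MX" "integrable M (\<phi> mT mT1 p w)" for mT mT1 w
  proof -
    have "weight_fns M NG MX X w"
      using that(1) by (simp add: synthetic_control_def)
    then show ?thesis
      by (rule true_propensity[OF _ trend_if_synthetic_control[OF that(1)] that(2-4)])
  qed
  ultimately show ?thesis
    using true_regression by blast
qed

end
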